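(* Let $d\in\mathbb N$, $L,a\in\mathbb R$, $b\in(a,\infty)$, $R\in[\max\{2,L,|a|,|b|\},\infty)$, let $(\Omega,\mathcal F,\mathbb P)$ be a probability space, let $X_m\colon\Omega\to[a,b]^d$, $m\in\mathbb N$, be i.i.d. random variables, let $\|\cdot\|$ be the standard (Euclidean) norm on $\mathbb R^d$, and let $\varphi\colon[a,b]^d\to[0,1]$ satisfy $|\varphi(x)-\varphi(y)|\le L\|x-y\|$ for all $x,y\in[a,b]^d$. For $\mathfrak d,M\in\mathbb N$, $\tau\in\{3,4,\dots\}$ with $\mathfrak d\ge\tau(d+1)+(\tau-3)\tau(\tau+1)+\tau+1$, $\theta\in[-R,R]^{\mathfrak d}$ and $\omega\in\Omega$ let $$\mathfrak E_{\mathfrak d,M,\tau}(\theta,\omega)=\frac1M\sum_{m=1}^M\bigl|\mathcal N^{\theta,\tau}(X_m(\omega))-\varphi(X_m(\omega))\bigr|^2 .$$ For every $\mathfrak d\in\mathbb N$ let $\Theta_{\mathfrak d,k}\colon\Omega\to[-R,R]^{\mathfrak d}$, $k\in\mathbb N$, be i.i.d. random variables with $\Theta_{\mathfrak d,1}$ continuous uniformly distributed on $[-R,R]^{\mathfrak d}$, and for $\mathfrak d,K,M,\tau\in\mathbb N$ let $\Xi_{\mathfrak d,K,M,\tau}=\Theta_{\mathfrak d,k^*}$ where $k^*=\min\{k\in\{1,\dots,K\}\colon \mathfrak E_{\mathfrak d,M,\tau}(\Theta_{\mathfrak d,k})=\min_{j\in\{1,\dots,K\}}\mathfrak E_{\mathfrak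 d,M,\tau}(\Theta_{\mathfrak d,j})\}$. Then there exists $c\in(0,\infty)$ such that for all $\mathfrak d,K,M,\tau\in\mathbb N$ and $\varepsilon\in(0,1]$ with $\tau\ge 2d(2dL(b-a)\varepsilon^{-1}+2)^d$ and $\mathfrak d\ge\tau(d+1)+(\tau-3)\tau(\tau+1)+\tau+1$ it holds that $$\mathbb P\Bigl(\int_{[a,b]^d}\bigl|\mathcal N^{\Xi_{\mathfrak d,K,M,\tau},\tau}(x)-\varphi(x)\bigr|\,\mathbb P_{X_1}(dx)>\varepsilon\Bigr)\le \exp\bigl(-K(c\tau)^{-\tau\mathfrak d}\varepsilon^{2\mathfrak d}\bigr)+2\exp\Bigl(\mathfrak d\ln\bigl((c\tau)^\tau\varepsilon^{-2}\bigr)-\frac{\varepsilon^4M}{c}\Bigr).$$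
   Context: For $r,s\in\mathbb N$, $k\in\mathbb N_0$ and $\theta=(\theta_1,\dots,\theta_{\mathfrak d})\in\mathbb R^{\mathfrak d}$ with $\mathfrak d\ge k+rs+r$, let $\mathcal A^{\theta,k}_{r,s}\colon\mathbb R^s\to\mathbb R^r$ be the affine map whose $i$-th component ($i=1,\dots,r$) is $x\mapsto\sum_{j=1}^s\theta_{k+(i-1)s+j}x_j+\theta_{k+rs+i}$. Let $\mathfrak c(y)=\min\{1,\max\{0,y\}\}$ for $y\in\mathbb R$ and let $\mathfrak R_\tau\colon\mathbb R^\tau\to\mathbb R^\tau$ apply $y\mapsto\max\{y,0\}$ componentwise. For $\mathfrak d,\tau\in\{3,4,\dots\}$ and $\theta\in\mathbb R^{\mathfrak d}$ with $\mathfrak d\ge\tau(d+1)+(\tau-3)\tau(\tau+1)+\tau+1$, the function $\mathcal N^{\theta,\tau}\colon\mathbb R^d\to\mathbb R$ is $$\mathcal N^{\theta,\tau}=\mathfrak c\circ\mathcal A^{\theta,\tau(d+1)+(\tau-3)\tau(\tau+1)}_{1,\tau}\circ\mathfrak R_\tau\circ\mathcal A^{\theta,\tau(d+1)+(\tau-4)\tau(\tau+1)}_{\tau,\tau}\circ\mathfrak R_\tau\circ\cdots\circ\mathcal A^{\theta,\tau(d+1)}_{\tau,\tau}\circ\mathfrak R_\tau\circ\mathcal A^{\theta,0}_{\tau,d},$$ i.e. a ReLU network with input dimension $d$, $\tau-2$ hidden layers of width $\tau$ (there are $\tau-3$ maps $\mathcal A^{\theta,\tau(d+1)+(j-1)\tau(\tau+1)}_{\tau,\tau}$,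 $j=1,\dots,\tau-3$), one output, and output clipped to $[0,1]$. *)

theory Defs
  imports "HOL-Probability.Probability"
begin

(* Vectors in R^n are represented as functions nat => real using the
   (1-based) components 1..n, as in the paper.  Parameter vectors theta
   likewise use components theta 1, ..., theta dd. *)

definition affine_map :: "(nat \<Rightarrow> real) \<Rightarrow> nat \<Rightarrow> nat \<Rightarrow> nat \<Rightarrow> (nat \<Rightarrow> real) \<Rightarrow> (nat \<Rightarrow> real)" where
  "affine_map \<theta> k r s x =
     (\<lambda>i. if i \<in> {1..r} then (\<Sum>j=1..s. \<theta> (k + (i - 1) * s + j) * x j) + \<theta> (k + r * s + i) else 0)"

definition relu_vec :: "(nat \<Rightarrow> real) \<Rightarrow> (nat \<Rightarrow> real)" where
  "relu_vec v = (\<lambda>i. max (v i) 0)"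

definition clip :: "real \<Rightarrow> real" where
  "clip y = min 1 (max 0 y)"

fun hidden_out :: "nat \<Rightarrow> (nat \<Rightarrow> real) \<Rightarrow> nat \<Rightarrow> nat \<Rightarrow> (nat \<Rightarrow> real) \<Rightarrow> (nat \<Rightarrow> real)" where
  "hidden_out d \<theta> \<tau> 0 x = affine_map \<theta> 0 \<tau> d x"
| "hidden_out d \<theta> \<tau> (Suc j) x =
     affine_map \<theta> (\<tau> * (d + 1) + j * \<tau> * (\<tau> + 1)) \<tau> \<tau> (relu_vec (hidden_out d \<theta> \<tau> j x))"

definition network :: "nat \<Rightarrow> (nat \<Rightarrow> real) \<Rightarrow> nat \<Rightarrow> (nat \<Rightarrow> real) \<Rightarrow> real" where
  "network d \<theta> \<tau> x =
     clip (affine_map \<theta> (\<tau> * (d + 1) + (\<tau> - 3) * \<tau> * (\<tau> + 1)) 1 \<tau>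
             (relu_vec (hidden_out d \<theta> \<tau> (\<tau> - 3) x)) 1)"

definition eucl_dist :: "nat \<Rightarrow> (nat \<Rightarrow> real) \<Rightarrow> (nat \<Rightarrow> real) \<Rightarrow> real" where
  "eucl_dist d x y = sqrt (\<Sum>i=1..d. (x i - y i)^2)"

definition cube :: "nat \<Rightarrow> real \<Rightarrow> real \<Rightarrow> (nat \<Rightarrow> real) set" where
  "cube n lo hi = PiE {1..n} (\<lambda>_. {lo..hi})"

abbreviation Rn :: "nat \<Rightarrow> (nat \<Rightarrow> real) measure" where
  "Rn n \<equiv> PiM {1..n} (\<lambda>_. lborel)"

definition emp_risk ::
  "nat \<Rightarrow> (nat \<Rightarrow> 'a \<Rightarrow> (nat \<Rightarrow> real)) \<Rightarrow> ((nat \<Rightarrow> real) \<Rightarrow> real) \<Rightarrow> nat \<Rightarrow> nat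
     \<Rightarrow> (nat \<Rightarrow> real) \<Rightarrow> 'a \<Rightarrow> real" where
  "emp_risk d X \<phi> M \<tau> \<theta> \<omega> =
     (1 / real M) * (\<Sum>m=1..M. \<bar>network d \<theta> \<tau> (X m \<omega>) - \<phi> (X m \<omega>)\<bar>^2)"

definition selected_param ::
  "nat \<Rightarrow> (nat \<Rightarrow> 'a \<Rightarrow> (nat \<Rightarrow> real)) \<Rightarrow> ((nat \<Rightarrow> real) \<Rightarrow> real)
     \<Rightarrow> (nat \<Rightarrow> nat \<Rightarrow> 'a \<Rightarrow> (nat \<Rightarrow> real)) \<Rightarrow> nat \<Rightarrow> nat \<Rightarrow> nat \<Rightarrow> nat \<Rightarrow> 'a \<Rightarrow> (nat \<Rightarrow> real)" where
  "selected_param d X \<phi> Theta dd K M \<tau> \<omega> =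
     Theta dd (LEAST k. k \<in> {1..K} \<and>
        emp_risk d X \<phi> M \<tau> (Theta dd k \<omega>) \<omega> =
          Min ((\<lambda>j. emp_risk d X \<phi> M \<tau> (Theta dd j \<omega>) \<omega>) ` {1..K})) \<omega>"

end

theory Submission
  imports Defs
begin

text \<open>
  On parameters bounded by \<open>R\<close> the network is Lipschitz in \<open>\<theta>\<close> for the maximum norm, with constant
  \<open>\<Lambda> = (2 * R * \<tau>) ^ \<tau>\<close>, uniformly over the input cube. Some \<open>\<theta>\<^sub>0\<close> approximates \<open>\<phi>\<close> up to \<open>\<epsilon> / 2\<close>:
  the McShane function \<open>max\<^sub>i (\<phi> p\<^sub>i - L * \<parallel>x - p\<^sub>i\<parallel>\<^sub>1)\<close> over a grid is computed sequentially, two hidden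
  layers per grid point, which needs width at most \<open>3 * d + 1\<close> and so fits into the given architecture.

  If one of the \<open>K\<close> samples hits the box of radius \<open>\<epsilon> / (8 * \<Lambda>)\<close> around \<open>\<theta>\<^sub>0\<close>, the minimal empirical risk is
  at most \<open>\<epsilon>\<^sup>2 / 2\<close>; missing it \<open>K\<close> times is the first term of the bound. If the empirical risk deviates
  by less than \<open>\<epsilon>\<^sup>2 / 4\<close> from the true risk at every point of an \<open>\<epsilon>\<^sup>2 / (16 * \<Lambda>)\<close>-net of the parameter cube,
  the true risk of the selected parameter is then at most \<open>\<epsilon>\<^sup>2\<close>, whence its mean absolute error is at most \<open>\<epsilon>\<close>;
  Hoeffding's inequality and a union bound over the net give the second term. Only net points and a
  fixed box occur in these events, so no measurability of suprema over \<open>\<theta>\<close> or of the minimizer is needed.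
\<close>

section \<open>Lipschitz dependence on the parameters\<close>

lemma cube_D: "x \<in> cube d a b \<Longrightarrow> j \<in> {1..d} \<Longrightarrow> a \<le> x j \<and> x j \<le> b"
  by (auto simp: cube_def PiE_def Pi_def)

section \<open>Finite nets of cubes from midpoints of equal cells\<close>

lemma nearest_midpoint:
  fixes lo hi x :: real
  assumes "lo < hi" "n \<ge> 1" "lo \<le> x" "x \<le> hi"
  obtains k where "k < n" "\<bar>x - (lo + (2 * real k + 1) * (hi - lo) / (2 * real n))\<bar> \<le> (hi - lo) / (2 * real n)"
proof -
  define h where "h = (hi - lo) / (2 * real n)"
  have h: "h > 0" and hn: "hi = lo + 2 * real n * h"
    using assms by (auto simp: h_def field_simps)
  \<comment> \<open>The floor reaches \<open>n\<close> only at \<open>x = hi\<close>; the minimum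
    with \<open>n - 1\<close> assigns this endpoint to the last cell.\<close>
  define k where "k = min (n - 1) (nat \<lfloor>(x - lo) / (2 * h)\<rfloor>)"
  have "\<bar>x - (lo + (2 * real k + 1) * h)\<bar> \<le> h"
  proof (cases "nat \<lfloor>(x - lo) / (2 * h)\<rfloor> \<le> n - 1")
    case True
    have "0 \<le> (x - lo) / (2 * h)" using assms h by simp
    then have k: "real k \<le> (x - lo) / (2 * h)" "(x - lo) / (2 * h) < real k + 1"
      using True unfolding k_def by linarith+
    show ?thesis using k h by (simp add: field_simps abs_le_iff)
  next
    case False
    have "0 \<le> (x - lo) / (2 * h)" using assms h by simp
    with False have "real n \<le> (x - lo) / (2 * h)" using assms(2) by linarith
    then have "x = hi" using h hn assms by (simp add: field_simps)
    have "real k = real n - 1" using False assms(2) by (auto simp: k_def)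
    then have "real n = real k + 1" by simp
    with \<open>x = hi\<close> have "x - (lo + (2 * real k + 1) * h) = h" unfolding hn by (simp add: algebra_simps)
    then show ?thesis using h by simp
  qed
  moreover have "k < n" using assms(2) by (auto simp: k_def)
  ultimately show ?thesis using that[of k] by (simp add: h_def)
qed

text \<open>A product of midpoint grids: each coordinate is off by at most half a cell. It serves
  twice, for the grid of the McShane function in the input cube and for the net of the parameter
  cube over which the union bound runs.\<close>

lemma cube_net_exists:
  assumes "lo < hi" "n \<ge> 1"
  obtains G where "finite G" "G \<noteq> {}" "G \<subseteq> cube m lo hi" "card G \<le> n ^ m"
    "\<And>x. x \<in> cube m lo hi \<Longrightarrow> \<exists>g\<in>G. \<forall>i\<in>{1..m}. \<bar>x i - g i\<bar> \<le> (hi - lo) / (2 * real n)"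
proof -
  define p where "p k = lo + (2 * real k + 1) * (hi - lo) / (2 * real n)" for k :: nat
  define G where "G = PiE {1..m} (\<lambda>_. p ` {..<n})"
  have p: "lo \<le> p k \<and> p k \<le> hi" if "k < n" for k
  proof -
    have "(2 * real k + 1) * (hi - lo) \<le> (2 * real n) * (hi - lo)"
      using that assms by (intro mult_right_mono) auto
    then have "(2 * real k + 1) * (hi - lo) / (2 * real n) \<le> hi - lo"
      using assms by (simp add: divide_le_eq mult.commute)
    moreover have "0 \<le> (2 * real k + 1) * (hi - lo) / (2 * real n)" using assms by simp
    ultimately show ?thesis unfolding p_def by linarith
  qed
  show ?thesis
  proof
    show "finite G" by (simp add: G_def finite_PiE)
    show "G \<noteq> {}" using assms(2) by (auto simp: G_def PiE_eq_empty_iff lessThan_empty_iff)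
    show "G \<subseteq> cube m lo hi" unfolding G_def cube_def using p by (intro PiE_mono) auto
    have "card (p ` {..<n}) \<le> n" using card_image_le[of "{..<n}" p] by simp
    then show "card G \<le> n ^ m"
      unfolding G_def by (simp add: card_PiE power_mono)
    fix x assume x: "x \<in> cube m lo hi"
    have "\<forall>i\<in>{1..m}. \<exists>k<n. \<bar>x i - p k\<bar> \<le> (hi - lo) / (2 * real n)"
    proof
      fix i assume "i \<in> {1..m}"
      then have "lo \<le> x i" "x i \<le> hi" using x by (auto simp: cube_def PiE_def Pi_def)
      from nearest_midpoint[OF assms this] show "\<exists>k<n. \<bar>x i - p k\<bar> \<le> (hi - lo) / (2 * real n)"
        unfolding p_def by metis
    qed
    then obtain k where k: "\<And>i. i \<in> {1..m} \<Longrightarrow> k i < n \<and> \<bar>x i - p (k i)\<bar> \<le> (hi - lo) / (2 * real n)"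
      by metis
    show "\<exists>g\<in>G. \<forall>i\<in>{1..m}. \<bar>x i - g i\<bar> \<le> (hi - lo) / (2 * real n)"
      using k by (intro bexI[of _ "restrict (\<lambda>i. p (k i)) {1..m}"]) (auto simp: G_def)
  qed
qed

section \<open>Size and perturbation of layers under bounded parameters\<close>

lemma affine_index_le:
  fixes i j r s :: nat
  assumes "i \<in> {1..r}" "j \<in> {1..s}"
  shows "(i - 1) * s + j \<le> r * s"
proof -
  have "(i - 1) * s + j \<le> (i - 1) * s + s" using assms by simp
  also have "\<dots> = i * s" using assms by (cases i) auto
  also have "\<dots> \<le> r * s" using assms by simp
  finally show ?thesis .
qed

lemma affine_map_bound:
  assumes "k + r * s + r \<le> D" "\<And>p. p \<in> {1..D} \<Longrightarrow> \<bar>\<theta> p\<bar> \<le> R" "0 \<le> R" "0 \<le> B"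
    "\<And>j. j \<in> {1..s} \<Longrightarrow> \<bar>x j\<bar> \<le> B"
  shows "\<bar>affine_map \<theta> k r s x i\<bar> \<le> R * (real s * B + 1)"
proof (cases "i \<in> {1..r}")
  case True
  have w: "\<bar>\<theta> (k + (i - 1) * s + j) * x j\<bar> \<le> R * B" if "j \<in> {1..s}" for j
    using affine_index_le[OF True that] that assms
    by (auto simp: abs_mult intro!: mult_mono)
  have "\<bar>affine_map \<theta> k r s x i\<bar> \<le> \<bar>\<Sum>j=1..s. \<theta> (k + (i - 1) * s + j) * x j\<bar> + \<bar>\<theta> (k + r * s + i)\<bar>"
    using True by (simp add: affine_map_def)
  also have "\<dots> \<le> (\<Sum>j=1..s. R * B) + R"
    using True assms(1,2) by (intro add_mono order.trans[OF sum_abs] sum_mono w) auto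
  finally show ?thesis by (simp add: algebra_simps)
qed (use assms in \<open>auto simp: affine_map_def\<close>)

text \<open>Split each product as \<open>(\<theta> - \<theta>') * x + \<theta>' * (x - x')\<close>:
  the parameter error meets the size \<open>B\<close> of the input, and the input error
  \<open>\<eta>\<close> meets the size \<open>R\<close> of the parameters. The bias contributes the
  last \<open>\<delta>\<close>.\<close>

lemma affine_map_diff:
  assumes "k + r * s + r \<le> D" "\<And>p. p \<in> {1..D} \<Longrightarrow> \<bar>\<theta>' p\<bar> \<le> R"
    "\<And>p. p \<in> {1..D} \<Longrightarrow> \<bar>\<theta> p - \<theta>' p\<bar> \<le> \<delta>" "0 \<le> R" "0 \<le> \<delta>" "0 \<le> B" "0 \<le> \<eta>"
    "\<And>j. j \<in> {1..s} \<Longrightarrow> \<bar>x j\<bar> \<le> B" "\<And>j. j \<in> {1..s} \<Longrightarrow> \<bar>x j - x' j\<bar> \<le> \<eta>"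
  shows "\<bar>affine_map \<theta> k r s x i - affine_map \<theta>' k r s x' i\<bar> \<le> real s * (\<delta> * B + R * \<eta>) + \<delta>"
proof (cases "i \<in> {1..r}")
  case True
  let ?q = "\<lambda>j. k + (i - 1) * s + j"
  have w: "\<bar>\<theta> (?q j) * x j - \<theta>' (?q j) * x' j\<bar> \<le> \<delta> * B + R * \<eta>" if j: "j \<in> {1..s}" for j
  proof -
    have q: "?q j \<in> {1..D}" using affine_index_le[OF True j] j assms(1) by auto
    have "\<theta> (?q j) * x j - \<theta>' (?q j) * x' j = (\<theta> (?q j) - \<theta>' (?q j)) * x j + \<theta>' (?q j) * (x j - x' j)"
      by (simp add: algebra_simps)
    also have "\<bar>\<dots>\<bar> \<le> \<bar>\<theta> (?q j) - \<theta>' (?q j)\<bar> * \<bar>x j\<bar> + \<bar>\<theta>' (?q j)\<bar> * \<bar>x j - x' j\<bar>"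
      by (metis abs_mult abs_triangle_ineq)
    also have "\<dots> \<le> \<delta> * B + R * \<eta>"
      using assms(2,3)[OF q] assms(8,9)[OF j] assms(4-7) by (intro add_mono mult_mono) auto
    finally show ?thesis .
  qed
  have "\<bar>affine_map \<theta> k r s x i - affine_map \<theta>' k r s x' i\<bar> =
      \<bar>(\<Sum>j=1..s. \<theta> (?q j) * x j - \<theta>' (?q j) * x' j) + (\<theta> (k + r * s + i) - \<theta>' (k + r * s + i))\<bar>"
    using True by (simp add: affine_map_def sum_subtractf)
  also have "\<dots> \<le> \<bar>\<Sum>j=1..s. \<theta> (?q j) * x j - \<theta>' (?q j) * x' j\<bar> + \<bar>\<theta> (k + r * s + i) - \<theta>' (k + r * s + i)\<bar>"
    by simp
  also have "\<dots> \<le> (\<Sum>j=1..s. \<delta> * B + R * \<eta>) + \<delta>"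
    using True assms(1,3) by (intro add_mono order.trans[OF sum_abs] sum_mono w) auto
  finally show ?thesis by simp
qed (use assms in \<open>auto simp: affine_map_def\<close>)

lemma relu_vec_abs_le: "\<bar>relu_vec v i\<bar> \<le> \<bar>v i\<bar>"
  by (simp add: relu_vec_def)

lemma relu_vec_diff_le: "\<bar>relu_vec v i - relu_vec w i\<bar> \<le> \<bar>v i - w i\<bar>"
  by (simp add: relu_vec_def)

lemma clip_diff_le: "\<bar>clip y - clip z\<bar> \<le> \<bar>y - z\<bar>"
  by (simp add: clip_def)

text \<open>Keeps the parameter block read by hidden layer \<open>Suc j\<close> inside
  \<open>{1..D}\<close>: the block with index \<open>j\<close> ends where the one with index
  \<open>Suc j\<close> would begin.\<close>

lemma hidden_offset_le:
  fixes j \<tau> D :: nat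
  assumes "Suc j \<le> \<tau> - 3" "\<tau> * (d + 1) + (\<tau> - 3) * \<tau> * (\<tau> + 1) + \<tau> + 1 \<le> D"
  shows "\<tau> * (d + 1) + j * \<tau> * (\<tau> + 1) + \<tau> * \<tau> + \<tau> \<le> D"
proof -
  have "Suc j * (\<tau> * (\<tau> + 1)) \<le> (\<tau> - 3) * (\<tau> * (\<tau> + 1))"
    using assms(1) by (rule mult_right_mono) simp
  moreover have "Suc j * (\<tau> * (\<tau> + 1)) = j * \<tau> * (\<tau> + 1) + \<tau> * \<tau> + \<tau>" by (simp add: algebra_simps)
  ultimately show ?thesis using assms(2) by (simp only: mult.assoc)
qed

text \<open>\<open>\<rho>\<close> is the growth factor of one layer: the weighted inputs account for
  \<open>R * \<tau>\<close>, and the bias is absorbed by one more \<open>R\<close> because the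
  preceding bound is at least 1. The first layer obeys the same rate since
  \<open>d \<le> \<tau>\<close> and the inputs are bounded by \<open>R\<close>.\<close>

lemma hidden_out_bound:
  fixes \<tau> D d :: nat and R :: real
  defines "\<rho> \<equiv> R * (real \<tau> + 1)"
  assumes D: "\<tau> * (d + 1) + (\<tau> - 3) * \<tau> * (\<tau> + 1) + \<tau> + 1 \<le> D" and R: "1 \<le> R" and d: "d \<le> \<tau>"
    and \<theta>: "\<And>p. p \<in> {1..D} \<Longrightarrow> \<bar>\<theta> p\<bar> \<le> R" and x: "\<And>j. j \<in> {1..d} \<Longrightarrow> \<bar>x j\<bar> \<le> R"
    and j: "j \<le> \<tau> - 3"
  shows "\<bar>hidden_out d \<theta> \<tau> j x i\<bar> \<le> R * \<rho> ^ (j + 1)"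
  using j
proof (induction j arbitrary: i)
  case 0
  have "\<bar>affine_map \<theta> 0 \<tau> d x i\<bar> \<le> R * (real d * R + 1)"
    using D R \<theta> x by (intro affine_map_bound[where D = D]) auto
  also have "real d * R + 1 \<le> \<rho>"
  proof -
    have "R * real d \<le> R * real \<tau>" using d R by (intro mult_left_mono) auto
    then show ?thesis using R unfolding \<rho>_def distrib_left mult.commute[of "real d"] by linarith
  qed
  finally show ?case using R by (simp add: mult_left_mono)
next
  case (Suc j)
  have \<rho>1: "1 \<le> \<rho>" using mult_mono[of 1 R 1 "real \<tau> + 1"] R by (simp add: \<rho>_def)
  have "\<bar>hidden_out d \<theta> \<tau> (Suc j) x i\<bar> \<le> R * (real \<tau> * (R * \<rho> ^ (j + 1)) + 1)"
    unfolding hidden_out.simps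
    using hidden_offset_le[OF Suc.prems D] R \<theta> \<rho>1 Suc
    by (intro affine_map_bound[where D = D] order.trans[OF relu_vec_abs_le]) auto
  also have "\<dots> \<le> R * (real \<tau> * (R * \<rho> ^ (j + 1)) + R * \<rho> ^ (j + 1))"
    using R one_le_power[OF \<rho>1, of "j+1"] mult_mono[of 1 R 1 "\<rho> ^ (j + 1)"]
    by (intro mult_left_mono add_left_mono) auto
  also have "\<dots> = R * \<rho> ^ (Suc j + 1)" by (simp add: \<rho>_def algebra_simps)
  finally show ?case .
qed

text \<open>One layer multiplies the inherited error \<open>\<eta>\<close> by at most
  \<open>\<rho>\<close>, and its own parameter error adds at most
  \<open>\<delta> * \<rho> ^ Suc m\<close>. Hence the prefactor grows only linearly with the
  depth.\<close>

lemma layer_diff_step: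
  fixes R \<rho> \<delta> \<eta> B s :: real
  assumes "\<rho> = R * (s + 1)" "1 \<le> R" "0 \<le> s" "0 \<le> \<delta>" "B = R * \<rho> ^ m" "\<eta> = real m * \<delta> * \<rho> ^ m" "m \<ge> 1"
  shows "s * (\<delta> * B + R * \<eta>) + \<delta> \<le> real (Suc m) * \<delta> * \<rho> ^ Suc m"
proof -
  have \<rho>1: "1 \<le> \<rho>" using mult_mono[of 1 R 1 "s + 1"] assms by simp
  have p: "1 \<le> R * \<rho> ^ m" using mult_mono[of 1 R 1 "\<rho> ^ m"] one_le_power[OF \<rho>1, of m] assms by simp
  have "s * R \<le> \<rho>" using assms by (simp add: algebra_simps)
  then have "s * R * \<eta> \<le> \<rho> * \<eta>" using assms \<rho>1 by (intro mult_right_mono) auto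
  moreover have "\<delta> * 1 \<le> \<delta> * (R * \<rho> ^ m)" using p assms by (intro mult_left_mono) auto
  moreover have "s * (\<delta> * B) + \<delta> * (R * \<rho> ^ m) = \<delta> * \<rho> ^ Suc m"
    using assms by (simp add: algebra_simps)
  ultimately have "s * (\<delta> * B + R * \<eta>) + \<delta> \<le> \<delta> * \<rho> ^ Suc m + \<rho> * \<eta>"
    by (simp add: algebra_simps)
  also have "\<dots> = real (Suc m) * \<delta> * \<rho> ^ Suc m" using assms by (simp add: algebra_simps)
  finally show ?thesis .
qed

lemma hidden_out_diff:
  fixes \<tau> D d :: nat and R :: real
  defines "\<rho> \<equiv> R * (real \<tau> + 1)"
  assumes D: "\<tau> * (d + 1) + (\<tau> - 3) * \<tau> * (\<tau> + 1) + \<tau> + 1 \<le> D" and R: "1 \<le> R" and d: "d \<le> \<tau>"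
    and \<theta>: "\<And>p. p \<in> {1..D} \<Longrightarrow> \<bar>\<theta> p\<bar> \<le> R" and \<theta>': "\<And>p. p \<in> {1..D} \<Longrightarrow> \<bar>\<theta>' p\<bar> \<le> R"
    and diff: "\<And>p. p \<in> {1..D} \<Longrightarrow> \<bar>\<theta> p - \<theta>' p\<bar> \<le> \<delta>" and \<delta>: "0 \<le> \<delta>"
    and x: "\<And>j. j \<in> {1..d} \<Longrightarrow> \<bar>x j\<bar> \<le> R"
    and j: "j \<le> \<tau> - 3"
  shows "\<bar>hidden_out d \<theta> \<tau> j x i - hidden_out d \<theta>' \<tau> j x i\<bar> \<le> real (j + 1) * \<delta> * \<rho> ^ (j + 1)"
  using j
proof (induction j arbitrary: i)
  case 0
  have "\<bar>affine_map \<theta> 0 \<tau> d x i - affine_map \<theta>' 0 \<tau> d x i\<bar> \<le> real d * (\<delta> * R + R * 0) + \<delta>"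
    using D R \<theta>' diff \<delta> x by (intro affine_map_diff[where D = D]) auto
  also have "\<dots> = \<delta> * (real d * R + 1)" by (simp add: algebra_simps)
  also have "\<dots> \<le> \<delta> * \<rho>"
  proof (intro mult_left_mono \<delta>)
    have "R * real d \<le> R * real \<tau>" using d R by (intro mult_left_mono) auto
    then show "real d * R + 1 \<le> \<rho>"
      using R unfolding \<rho>_def distrib_left mult.commute[of "real d"] by linarith
  qed
  finally show ?case by simp
next
  case (Suc j)
  have \<rho>0: "0 \<le> \<rho>" using R by (simp add: \<rho>_def)
  have "\<bar>hidden_out d \<theta> \<tau> (Suc j) x i - hidden_out d \<theta>' \<tau> (Suc j) x i\<bar> \<le>
      real \<tau> * (\<delta> * (R * \<rho> ^ (j + 1)) + R * (real (j + 1) * \<delta> * \<rho> ^ (j + 1))) + \<delta>"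
    unfolding hidden_out.simps
    using hidden_offset_le[OF Suc.prems D] R \<theta>' diff \<delta> \<rho>0 Suc
      hidden_out_bound[of \<tau> d D R \<theta> x j, OF D R d \<theta> x]
    by (intro affine_map_diff[where D = D] order.trans[OF relu_vec_abs_le] order.trans[OF relu_vec_diff_le])
       (auto simp: \<rho>_def)
  also have "\<dots> \<le> real (Suc (j + 1)) * \<delta> * \<rho> ^ Suc (j + 1)"
    using R \<delta> by (intro layer_diff_step[where R = R]) (auto simp: \<rho>_def)
  finally show ?case by simp
qed

lemma network_lipschitz:
  fixes \<tau> dd d :: nat and R :: real
  assumes D: "\<tau> * (d + 1) + (\<tau> - 3) * \<tau> * (\<tau> + 1) + \<tau> + 1 \<le> dd" and R: "1 \<le> R" and d: "d \<le> \<tau>"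
    and \<tau>: "3 \<le> \<tau>" and ab: "\<bar>a\<bar> \<le> R" "\<bar>b\<bar> \<le> R"
    and \<theta>: "\<theta> \<in> cube dd (-R) R" and \<theta>': "\<theta>' \<in> cube dd (-R) R"
    and diff: "\<And>p. p \<in> {1..dd} \<Longrightarrow> \<bar>\<theta> p - \<theta>' p\<bar> \<le> \<delta>"
    and x: "x \<in> cube d a b"
  shows "\<bar>network d \<theta> \<tau> x - network d \<theta>' \<tau> x\<bar> \<le> (2 * R * real \<tau>) ^ \<tau> * \<delta>"
proof -
  define \<rho> where "\<rho> = R * (real \<tau> + 1)"
  define j where "j = \<tau> - 3"
  have \<rho>0: "1 \<le> \<rho>" using mult_mono[of 1 R 1 "real \<tau> + 1"] R by (simp add: \<rho>_def)
  have "1 \<in> {1..dd}" using D by simp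
  from diff[OF this] have \<delta>: "0 \<le> \<delta>" by linarith
  have xR: "\<bar>x j\<bar> \<le> R" if "j \<in> {1..d}" for j
  proof -
    have "a \<le> x j \<and> x j \<le> b" using x that by (auto simp: cube_def PiE_def Pi_def)
    then show ?thesis using ab by linarith
  qed
  have \<theta>R: "\<bar>\<theta> p\<bar> \<le> R" "\<bar>\<theta>' p\<bar> \<le> R" if "p \<in> {1..dd}" for p
    using \<theta> \<theta>' that by (auto simp: cube_def PiE_def Pi_def abs_le_iff minus_le_iff)
  have "\<bar>network d \<theta> \<tau> x - network d \<theta>' \<tau> x\<bar> \<le>
      real \<tau> * (\<delta> * (R * \<rho> ^ (j + 1)) + R * (real (j + 1) * \<delta> * \<rho> ^ (j + 1))) + \<delta>"
    unfolding network_def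
    using D R \<theta>R diff \<delta> \<rho>0
      hidden_out_bound[of \<tau> d dd R \<theta> x j, OF D R d \<theta>R(1) xR]
      hidden_out_diff[of \<tau> d dd R \<theta> \<theta>' \<delta> x j, OF D R d \<theta>R diff \<delta> xR]
    by (intro order.trans[OF clip_diff_le] affine_map_diff[where D = dd]
          order.trans[OF relu_vec_abs_le] order.trans[OF relu_vec_diff_le])
       (auto simp: \<rho>_def j_def)
  also have "\<dots> \<le> real (Suc (j + 1)) * \<delta> * \<rho> ^ Suc (j + 1)"
    using R \<delta> by (intro layer_diff_step[where R = R]) (auto simp: \<rho>_def)
  \<comment> \<open>The linear prefactor \<open>\<tau> - 1\<close> is at most \<open>\<rho>\<close>;
    this raises the exponent from \<open>\<tau> - 1\<close>, the number of affine maps, to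
    \<open>\<tau>\<close>.\<close>
  also have "\<dots> \<le> \<rho> * \<delta> * \<rho> ^ Suc (j + 1)"
  proof (intro mult_right_mono \<delta>)
    have "1 * (real \<tau> + 1) \<le> R * (real \<tau> + 1)" using R by (intro mult_right_mono) auto
    moreover have "real (Suc (j + 1)) \<le> 1 * (real \<tau> + 1)" using \<tau> by (simp add: j_def)
    ultimately show "real (Suc (j + 1)) \<le> \<rho>" unfolding \<rho>_def by linarith
  qed (use \<rho>0 in simp)
  also have "\<dots> = \<rho> ^ \<tau> * \<delta>"
  proof -
    have "\<tau> = Suc (Suc (j + 1))" using \<tau> by (simp add: j_def)
    then show ?thesis by (metis (no_types) mult.assoc mult.commute power_Suc)
  qed
  also have "\<dots> \<le> (2 * R * real \<tau>) ^ \<tau> * \<delta>"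
  proof (intro mult_right_mono power_mono \<delta>)
    have "R * (real \<tau> + 1) \<le> R * (2 * real \<tau>)" using R \<tau> by (intro mult_left_mono) auto
    then show "\<rho> \<le> 2 * R * real \<tau>" by (simp add: \<rho>_def)
  qed (use \<rho>0 in simp)
  finally show ?thesis .
qed

section \<open>Approximation by networks\<close>

definition dense_layer :: "nat \<Rightarrow> nat \<Rightarrow> (nat \<Rightarrow> nat \<Rightarrow> real) \<Rightarrow> (nat \<Rightarrow> real) \<Rightarrow> (nat \<Rightarrow> real) \<Rightarrow> nat \<Rightarrow> real" where
  "dense_layer r s W B x = (\<lambda>i. if i \<in> {1..r} then (\<Sum>j=1..s. W i j * x j) + B i else 0)"

text \<open>The row-major order of \<open>affine_map\<close>, weights first and biases last, but
  with positions counted from 0 so that \<open>div\<close> and \<open>mod\<close> recover row and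
  column.\<close>

definition flat_layer :: "nat \<Rightarrow> nat \<Rightarrow> (nat \<Rightarrow> nat \<Rightarrow> real) \<Rightarrow> (nat \<Rightarrow> real) \<Rightarrow> nat \<Rightarrow> real" where
  "flat_layer r s W B q = (if q < r * s then W (q div s + 1) (q mod s + 1) else B (q - r * s + 1))"

lemma affine_map_flat_layer:
  assumes "\<And>q. q < r * s + r \<Longrightarrow> \<theta> (k + q + 1) = flat_layer r s W B q"
  shows "affine_map \<theta> k r s x = dense_layer r s W B x"
proof
  fix i
  show "affine_map \<theta> k r s x i = dense_layer r s W B x i"
  proof (cases "i \<in> {1..r}")
    case True
    have "\<theta> (k + (i - 1) * s + j) = W i j" if j: "j \<in> {1..s}" for j
    proof -
      define e where "e = j - 1"
      define q where "q = (i - 1) * s + e"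
      have e: "j = e + 1" "e < s" using j by (auto simp: e_def)
      have q: "q < r * s" using affine_index_le[OF True j] by (auto simp: q_def e)
      have "q div s = i - 1" "q mod s = e" using e by (auto simp: q_def)
      then have "flat_layer r s W B q = W i j" using q True e by (simp add: flat_layer_def)
      moreover have "k + (i - 1) * s + j = k + q + 1" by (simp add: q_def e)
      ultimately show ?thesis using assms[of q] q by (simp only: trans_less_add1)
    qed
    moreover have "\<theta> (k + r * s + i) = B i"
      using assms[of "r * s + (i - 1)"] True by (auto simp: flat_layer_def add.assoc)
    ultimately show ?thesis using True by (simp add: affine_map_def dense_layer_def)
  qed (simp only: affine_map_def dense_layer_def if_False)
qed

lemma network_weights_realizable:
  fixes W :: "nat \<Rightarrow> nat \<Rightarrow> nat \<Rightarrow> real" and B :: "nat \<Rightarrow> nat \<Rightarrow> real"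
  assumes \<tau>: "3 \<le> \<tau>" and R: "0 \<le> R"
    and W: "\<And>l i j. \<bar>W l i j\<bar> \<le> R" and B: "\<And>l i. \<bar>B l i\<bar> \<le> R"
    and D: "\<tau> * (d + 1) + (\<tau> - 3) * \<tau> * (\<tau> + 1) + \<tau> + 1 \<le> dd"
  obtains \<theta> where "\<theta> \<in> cube dd (-R) R"
    "\<And>x. affine_map \<theta> 0 \<tau> d x = dense_layer \<tau> d (W 0) (B 0) x"
    "\<And>l x. l < \<tau> - 3 \<Longrightarrow> affine_map \<theta> (\<tau> * (d + 1) + l * \<tau> * (\<tau> + 1)) \<tau> \<tau> x
       = dense_layer \<tau> \<tau> (W (l + 1)) (B (l + 1)) x"
    "\<And>x. affine_map \<theta> (\<tau> * (d + 1) + (\<tau> - 3) * \<tau> * (\<tau> + 1)) 1 \<tau> x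
       = dense_layer 1 \<tau> (W (\<tau> - 2)) (B (\<tau> - 2)) x"
proof -
  define c where "c = \<tau> * (\<tau> + 1)"
  \<comment> \<open>Behind the first layer the vector is cut into blocks of length \<open>c\<close>.
    The output layer is block \<open>\<tau> - 3\<close> and occupies only its first
    \<open>\<tau> + 1\<close> positions. All later positions are filled by the same formula, so the
    bound \<open>R\<close> on the entries of \<open>W\<close> and \<open>B\<close> puts
    \<open>\<theta>\<close> into the cube.\<close>
  define \<theta>0 where "\<theta>0 p = (let q = p - 1; q' = q - \<tau> * (d + 1); l = q' div c in
     if q < \<tau> * (d + 1) then flat_layer \<tau> d (W 0) (B 0) q
     else flat_layer (if l < \<tau> - 3 then \<tau> else 1) \<tau> (W (l + 1)) (B (l + 1)) (q' mod c))" for p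
  define \<theta> where "\<theta> = restrict \<theta>0 {1..dd}"
  have flat: "\<bar>flat_layer r s (W l) (B l) q\<bar> \<le> R" for r s l q
    using W B by (simp add: flat_layer_def)
  have c: "\<tau> + 1 \<le> c" "c = \<tau> * \<tau> + \<tau>" using \<tau> by (auto simp: c_def)
  have D': "\<tau> * (d + 1) + (\<tau> - 3) * c + \<tau> + 1 \<le> dd"
    using D by (simp only: c_def mult.assoc)
  have block: "\<theta> (\<tau> * (d + 1) + l * \<tau> * (\<tau> + 1) + q + 1)
      = flat_layer (if l < \<tau> - 3 then \<tau> else 1) \<tau> (W (l + 1)) (B (l + 1)) q"
    if "l \<le> \<tau> - 3" "q < c" "l = \<tau> - 3 \<Longrightarrow> q < \<tau> + 1" for l q
  proof -
    have "l * c + q < (\<tau> - 3) * c + \<tau> + 1"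
    proof (cases "l = \<tau> - 3")
      case False
      then have "Suc l * c \<le> (\<tau> - 3) * c" using that(1) by (intro mult_right_mono) auto
      then show ?thesis using that(2) by simp
    qed (use that(3) in simp)
    then have "\<tau> * (d + 1) + l * \<tau> * (\<tau> + 1) + q + 1 \<in> {1..dd}"
      using D' by (simp only: c_def mult.assoc atLeastAtMost_iff) linarith
    moreover have "\<tau> * (d + 1) + l * \<tau> * (\<tau> + 1) + q + 1 = \<tau> * (d + 1) + (l * c + q) + 1"
      by (simp only: c_def mult.assoc)
    moreover have "(l * c + q) div c = l" "(l * c + q) mod c = q" using that(2) by auto
    ultimately show ?thesis by (simp only: \<theta>_def restrict_apply \<theta>0_def Let_def if_True) simp
  qed
  show ?thesis
  proof
    show "\<theta> \<in> cube dd (-R) R"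
      using flat by (auto simp: \<theta>_def cube_def \<theta>0_def Let_def abs_le_iff minus_le_iff)
    show "affine_map \<theta> 0 \<tau> d x = dense_layer \<tau> d (W 0) (B 0) x" for x
      using D by (intro affine_map_flat_layer) (auto simp: \<theta>_def \<theta>0_def)
    show "affine_map \<theta> (\<tau> * (d + 1) + l * \<tau> * (\<tau> + 1)) \<tau> \<tau> x
       = dense_layer \<tau> \<tau> (W (l + 1)) (B (l + 1)) x" if "l < \<tau> - 3" for l x
      using block[of l] that c by (intro affine_map_flat_layer) auto
    have "\<tau> - 3 + 1 = \<tau> - 2" using \<tau> by simp
    then show "affine_map \<theta> (\<tau> * (d + 1) + (\<tau> - 3) * \<tau> * (\<tau> + 1)) 1 \<tau> x
       = dense_layer 1 \<tau> (W (\<tau> - 2)) (B (\<tau> - 2)) x" for x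
      using block[of "\<tau> - 3"] c by (intro affine_map_flat_layer) auto
  qed
qed

text \<open>McShane's extension formula as a running maximum. The l1 distance is a sum of absolute
  values, hence within reach of ReLU layers, and it dominates the Euclidean distance, so the
  Lipschitz condition carries over. The start value 0 is harmless for targets with values in
  [0,1].\<close>

fun mcshane :: "nat \<Rightarrow> real \<Rightarrow> (nat \<Rightarrow> real) \<Rightarrow> (nat \<Rightarrow> nat \<Rightarrow> real) \<Rightarrow> (nat \<Rightarrow> real) \<Rightarrow> nat \<Rightarrow> real" where
  "mcshane d L v p x 0 = 0"
| "mcshane d L v p x (Suc n) = max (mcshane d L v p x n) (v n - L * (\<Sum>j=1..d. \<bar>x j - p n j\<bar>))"

lemma mcshane_nonneg: "0 \<le> mcshane d L v p x n"
  by (induction n) auto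

lemma mcshane_ge: "i < n \<Longrightarrow> v i - L * (\<Sum>j=1..d. \<bar>x j - p i j\<bar>) \<le> mcshane d L v p x n"
  by (induction n) (auto simp: less_Suc_eq)

lemma mcshane_le:
  "0 \<le> u \<Longrightarrow> (\<And>i. v i - L * (\<Sum>j=1..d. \<bar>x j - p i j\<bar>) \<le> u) \<Longrightarrow> mcshane d L v p x n \<le> u"
  by (induction n) auto

text \<open>
  Layout of the hidden neurons. After an even layer they carry the shifted input, the positive and
  negative parts of \<open>x - p\<close> for the current grid point \<open>p\<close>, and the running McShane maximum \<open>m\<close>;
  an odd layer replaces the middle block by \<open>w\<close>, the increment of the maximum.
  All quantities are halved: \<open>b - a\<close> and \<open>p - a\<close> may reach \<open>2 * R\<close>, but biases are limited to \<open>R\<close>.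
  The factor 2 is restored by the output weights, which is where \<open>R \<ge> 2\<close> is needed.
\<close>

definition even_state :: "nat \<Rightarrow> real \<Rightarrow> (nat \<Rightarrow> real) \<Rightarrow> (nat \<Rightarrow> real) \<Rightarrow> real \<Rightarrow> nat \<Rightarrow> real" where
  "even_state d a x p m = (\<lambda>k. if k \<in> {1..d} then (x k - a) / 2
     else if k \<in> {d+1..2*d} then max ((x (k - d) - p (k - d)) / 2) 0
     else if k \<in> {2*d+1..3*d} then max ((p (k - 2*d) - x (k - 2*d)) / 2) 0
     else if k = 3*d+1 then m else 0)"

definition odd_state :: "nat \<Rightarrow> real \<Rightarrow> (nat \<Rightarrow> real) \<Rightarrow> real \<Rightarrow> real \<Rightarrow> nat \<Rightarrow> real" where
  "odd_state d a x w m = (\<lambda>k. if k \<in> {1..d} then (x k - a) / 2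
     else if k = d+1 then w else if k = 3*d+1 then m else 0)"

text \<open>The last row performs the update of the running maximum: in an \<open>odd_state\<close>
  the increment sits at \<open>d+1\<close> and the old maximum at \<open>3*d+1\<close>.\<close>

definition even_weights :: "nat \<Rightarrow> real \<Rightarrow> nat \<Rightarrow> nat \<Rightarrow> real" where
  "even_weights d s = (\<lambda>i j. if i \<in> {1..d} then (if j = i then s else 0)
     else if i \<in> {d+1..2*d} then (if j = i - d then s else 0)
     else if i \<in> {2*d+1..3*d} then (if j = i - 2*d then -s else 0)
     else if i = 3*d+1 then (if j = d+1 then 1 else 0) + (if j = 3*d+1 then 1 else 0) else 0)"

text \<open>Here \<open>a\<close> is the shift already present in the incoming coordinates: 0 when
  the raw input is read, the left endpoint of the cube once they are \<open>(x - a) / 2\<close>. The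
  argument \<open>y0\<close> supplies the shift still missing in the carried input.\<close>

definition even_bias :: "nat \<Rightarrow> real \<Rightarrow> real \<Rightarrow> (nat \<Rightarrow> real) \<Rightarrow> nat \<Rightarrow> real" where
  "even_bias d y0 a p = (\<lambda>i. if i \<in> {1..d} then y0
     else if i \<in> {d+1..2*d} then (a - p (i - d)) / 2
     else if i \<in> {2*d+1..3*d} then (p (i - 2*d) - a) / 2 else 0)"

text \<open>Together with the bias, neuron \<open>d+1\<close> receives the halved new McShane term
  \<open>t\<close> minus the stored maximum \<open>m\<close>. Its positive part is the increment,
  because \<open>max m t = m + max (t - m) 0\<close>.\<close>

definition odd_weights :: "nat \<Rightarrow> real \<Rightarrow> nat \<Rightarrow> nat \<Rightarrow> real" where
  "odd_weights d L = (\<lambda>i j. if i \<in> {1..d} then (if j = i then 1 else 0)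
     else if i = d+1 then (if j \<in> {d+1..3*d} then -L else 0) + (if j = 3*d+1 then -1 else 0)
     else if i = 3*d+1 then (if j = 3*d+1 then 1 else 0) else 0)"

definition odd_bias :: "nat \<Rightarrow> real \<Rightarrow> nat \<Rightarrow> real" where
  "odd_bias d u = (\<lambda>i. if i = d+1 then u / 2 else 0)"

section \<open>One step of the McShane recursion in two ReLU layers\<close>

lemma sum_single_weight:
  fixes f :: "nat \<Rightarrow> real"
  assumes "c \<in> {1..n}"
  shows "(\<Sum>j=1..n. (if j = c then u else 0) * f j) = u * f c"
  using assms by (simp add: if_distrib[where f = "\<lambda>t. t * _"] sum.delta cong: if_cong)

text \<open>By \<open>\<bar>t\<bar> = max t 0 + max (-t) 0\<close>, the two middle blocks together
  carry half the l1 distance.\<close>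

lemma even_state_l1_sum:
  "(\<Sum>k\<in>{d+1..3*d}. even_state d a x p m k) = (\<Sum>j=1..d. \<bar>x j - p j\<bar>) / 2"
proof -
  have "(\<Sum>k\<in>{d+1..3*d}. even_state d a x p m k) =
      (\<Sum>k\<in>{d+1..2*d}. even_state d a x p m k) + (\<Sum>k\<in>{2*d+1..3*d}. even_state d a x p m k)"
    by (subst sum.union_disjoint[symmetric]) (auto intro!: sum.cong)
  also have "(\<Sum>k\<in>{d+1..2*d}. even_state d a x p m k) = (\<Sum>j\<in>{1..d}. max ((x j - p j) / 2) 0)"
    by (rule sum.reindex_bij_witness[of _ "\<lambda>j. j + d" "\<lambda>k. k - d"]) (auto simp: even_state_def)
  also have "(\<Sum>k\<in>{2*d+1..3*d}. even_state d a x p m k) = (\<Sum>j\<in>{1..d}. max ((p j - x j) / 2) 0)"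
    by (rule sum.reindex_bij_witness[of _ "\<lambda>j. j + 2*d" "\<lambda>k. k - 2*d"]) (auto simp: even_state_def)
  also have "(\<Sum>j\<in>{1..d}. max ((x j - p j) / 2) 0) + (\<Sum>j\<in>{1..d}. max ((p j - x j) / 2) 0)
      = (\<Sum>j\<in>{1..d}. \<bar>x j - p j\<bar> / 2)"
    unfolding sum.distrib[symmetric] by (rule sum.cong) (auto simp: max_def)
  finally show ?thesis by (simp add: sum_divide_distrib)
qed

text \<open>ReLU preserves the carried input and the maximum because \<open>a \<le> x j\<close> and
  \<open>0 \<le> m\<close>; only neuron \<open>d+1\<close> is really truncated.\<close>

lemma relu_odd_layer:
  assumes \<tau>: "3 * d + 1 \<le> \<tau>" and d: "1 \<le> d" and x: "\<And>j. j \<in> {1..d} \<Longrightarrow> a \<le> x j" and m: "0 \<le> m"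
  shows "relu_vec (dense_layer \<tau> \<tau> (odd_weights d L) (odd_bias d u) (even_state d a x p m)) =
    odd_state d a x (max (u / 2 - L * ((\<Sum>j=1..d. \<bar>x j - p j\<bar>) / 2) - m) 0) m"
proof
  fix i
  let ?S = "even_state d a x p m"
  have m': "?S (3*d+1) = m" by (simp add: even_state_def)
  consider "i \<in> {1..d}" | "i = d+1" | "i = 3*d+1" | "i \<notin> {1..d}" "i \<noteq> d+1" "i \<noteq> 3*d+1" by blast
  then show "relu_vec (dense_layer \<tau> \<tau> (odd_weights d L) (odd_bias d u) ?S) i =
    odd_state d a x (max (u / 2 - L * ((\<Sum>j=1..d. \<bar>x j - p j\<bar>) / 2) - m) 0) m i"
  proof cases
    case 1
    then have "i \<in> {1..\<tau>}" using \<tau> by auto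
    moreover from this have "(\<Sum>j=1..\<tau>. odd_weights d L i j * ?S j) = ?S i"
      using 1 sum_single_weight[of i \<tau> 1 ?S] by (simp only: odd_weights_def if_True)
    ultimately show ?thesis using 1 x[of i]
      by (simp add: relu_vec_def dense_layer_def odd_bias_def) (simp add: even_state_def odd_state_def)
  next
    case 2
    have i: "i \<in> {1..\<tau>}" "i \<notin> {1..d}" "3*d+1 \<in> {1..\<tau>}" using 2 \<tau> by auto
    have "(\<Sum>j=1..\<tau>. odd_weights d L i j * ?S j) =
        (\<Sum>j=1..\<tau>. (if j \<in> {d+1..3*d} then -L else 0) * ?S j) + (\<Sum>j=1..\<tau>. (if j = 3*d+1 then -1 else 0) * ?S j)"
      unfolding sum.distrib[symmetric] using 2 i(2)
      by (intro sum.cong) (auto simp: odd_weights_def)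
    also have "(\<Sum>j=1..\<tau>. (if j \<in> {d+1..3*d} then -L else 0) * ?S j) = (\<Sum>j\<in>{d+1..3*d}. -L * ?S j)"
      using \<tau> by (intro sum.mono_neutral_cong_right) auto
    also have "\<dots> = -L * ((\<Sum>j=1..d. \<bar>x j - p j\<bar>) / 2)"
      unfolding sum_distrib_left[symmetric] even_state_l1_sum ..
    also have "(\<Sum>j=1..\<tau>. (if j = 3*d+1 then -1 else 0) * ?S j) = - m"
      unfolding sum_single_weight[OF i(3)] m' by simp
    finally show ?thesis using i 2
      by (simp add: relu_vec_def dense_layer_def odd_bias_def odd_state_def)
  next
    case 3
    then have "i \<in> {1..\<tau>}" "i \<notin> {1..d}" "i \<noteq> d+1" using \<tau> d by auto
    moreover from this have "(\<Sum>j=1..\<tau>. odd_weights d L i j * ?S j) = m"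
      using 3 sum_single_weight[of i \<tau> 1 ?S] m' by (simp only: odd_weights_def if_True if_False refl)
    ultimately show ?thesis using 3 m
      by (simp add: relu_vec_def dense_layer_def odd_bias_def odd_state_def)
  next
    case 4
    then show ?thesis
      by (auto simp: relu_vec_def dense_layer_def odd_weights_def odd_bias_def odd_state_def)
  qed
qed

text \<open>The scale \<open>c\<close> is 1/2 when the layer reads the input itself and 1 for the later even layers.\<close>
lemma relu_even_layer:
  assumes \<tau>: "3 * d + 1 \<le> \<tau>" and d: "1 \<le> d" "d \<le> s" and z: "\<And>j. j \<in> {1..d} \<Longrightarrow> c * z j + y0 = (x j - a) / 2"
    and x: "\<And>j. j \<in> {1..d} \<Longrightarrow> a \<le> x j"
    and bias: "\<And>j. j \<in> {1..d} \<Longrightarrow> c * z j + (a' - p j) / 2 = (x j - p j) / 2"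
    and m: "(\<Sum>j=1..s. ((if j = d+1 then 1 else 0) + (if j = 3*d+1 then 1 else 0)) * z j) = m" "0 \<le> m"
  shows "relu_vec (dense_layer \<tau> s (even_weights d c) (even_bias d y0 a' p) z) = even_state d a x p m"
proof
  fix i
  consider "i \<in> {1..d}" | "i \<in> {d+1..2*d}" | "i \<in> {2*d+1..3*d}" | "i = 3*d+1" | "i \<notin> {1..3*d+1}" by fastforce
  then show "relu_vec (dense_layer \<tau> s (even_weights d c) (even_bias d y0 a' p) z) i = even_state d a x p m i"
  proof cases
    case 1
    then have "i \<in> {1..\<tau>}" "i \<in> {1..s}" using \<tau> d by auto
    moreover from this have "(\<Sum>j=1..s. even_weights d c i j * z j) = c * z i"
      using 1 sum_single_weight[of i s c z] by (simp only: even_weights_def if_True)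
    ultimately show ?thesis using 1 x[OF 1] z[OF 1]
      by (simp add: relu_vec_def dense_layer_def even_bias_def even_state_def)
  next
    case 2
    then have i: "i \<in> {1..\<tau>}" "i \<notin> {1..d}" "i - d \<in> {1..d}" "i - d \<in> {1..s}" using \<tau> d by auto
    have "(\<Sum>j=1..s. even_weights d c i j * z j) = c * z (i - d)"
      using 2 i(2) sum_single_weight[OF i(4), of c z] by (simp add: even_weights_def)
    then have "dense_layer \<tau> s (even_weights d c) (even_bias d y0 a' p) z i = (x (i - d) - p (i - d)) / 2"
      using 2 i(1,2) bias[OF i(3)] by (simp only: dense_layer_def even_bias_def if_True if_False)
    then show ?thesis using 2 i(1,2) by (simp only: relu_vec_def even_state_def if_True if_False)
  next
    case 3
    then have i: "i \<in> {1..\<tau>}" "i \<notin> {1..d}" "i \<notin> {d+1..2*d}" "i - 2*d \<in> {1..d}" "i - 2*d \<in> {1..s}"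
      using \<tau> d by auto
    have "(\<Sum>j=1..s. even_weights d c i j * z j) = - c * z (i - 2*d)"
      using 3 i(2,3) sum_single_weight[OF i(5), of "-c" z] by (simp add: even_weights_def)
    moreover have "- c * z (i - 2*d) + (p (i - 2*d) - a') / 2 = (p (i - 2*d) - x (i - 2*d)) / 2"
      using bias[OF i(4)] by (simp add: field_simps)
    ultimately have "dense_layer \<tau> s (even_weights d c) (even_bias d y0 a' p) z i = (p (i - 2*d) - x (i - 2*d)) / 2"
      using 3 i(1-3) by (simp only: dense_layer_def even_bias_def if_True if_False)
    then show ?thesis using 3 i(1-3) by (simp only: relu_vec_def even_state_def if_True if_False)
  next
    case 4
    then have i: "i \<in> {1..\<tau>}" "i \<notin> {1..d}" "i \<notin> {d+1..2*d}" "i \<notin> {2*d+1..3*d}" using \<tau> by auto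
    have "(\<Sum>j=1..s. even_weights d c i j * z j) = m"
      unfolding m(1)[symmetric] using 4 i(2-) by (simp only: even_weights_def if_True if_False simp_thms)
    then show ?thesis using 4 i m(2)
      by (simp only: relu_vec_def dense_layer_def even_bias_def even_state_def if_True if_False simp_thms)
  next
    case 5
    then show ?thesis
      by (auto simp: relu_vec_def dense_layer_def even_weights_def even_bias_def even_state_def)
  qed
qed

text \<open>Rows with two kinds of nonzero entries are written as sums of two conditionals. No
  column meets both conditions, so the bound stays \<open>R\<close> instead of
  \<open>2 * R\<close>.\<close>

lemma two_weights_bound:
  fixes u w R :: real
  assumes "\<bar>u\<bar> \<le> R" "\<bar>w\<bar> \<le> R" "\<not> (P \<and> Q)"
  shows "\<bar>(if P then u else 0) + (if Q then w else 0)\<bar> \<le> R"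
  using assms by (cases P; cases Q) auto

lemma abs_if_le:
  fixes x y R :: real
  shows "(P \<Longrightarrow> \<bar>x\<bar> \<le> R) \<Longrightarrow> (\<not> P \<Longrightarrow> \<bar>y\<bar> \<le> R) \<Longrightarrow> \<bar>if P then x else y\<bar> \<le> R"
  by simp

lemma even_weights_bound:
  assumes "1 \<le> d" "1 \<le> R" "\<bar>c\<bar> \<le> R"
  shows "\<bar>even_weights d c i j\<bar> \<le> R"
  unfolding even_weights_def by (intro abs_if_le two_weights_bound) (use assms in auto)

lemma odd_weights_bound:
  assumes "1 \<le> R" "\<bar>L\<bar> \<le> R"
  shows "\<bar>odd_weights d L i j\<bar> \<le> R"
  unfolding odd_weights_def by (intro abs_if_le two_weights_bound) (use assms in auto)

text \<open>Counting hidden layers from 0, layers \<open>2 * i\<close> and \<open>2 * i + 1\<close>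
  process the point \<open>p i\<close>; thus \<open>\<tau> - 2\<close> hidden layers treat
  \<open>(\<tau> - 2) div 2\<close> points, and an unpaired last layer leaves the maximum as it
  is.\<close>

lemma mcshane_network:
  fixes \<tau> dd d :: nat and L R a b :: real and p :: "nat \<Rightarrow> nat \<Rightarrow> real"
  assumes D: "\<tau> * (d + 1) + (\<tau> - 3) * \<tau> * (\<tau> + 1) + \<tau> + 1 \<le> dd"
    and \<tau>: "3 * d + 1 \<le> \<tau>" and d: "1 \<le> d"
    and R: "2 \<le> R" "0 \<le> L" "L \<le> R" "\<bar>a\<bar> \<le> R" "\<bar>b\<bar> \<le> R"
    and p: "\<And>i. p i \<in> cube d a b" and v: "\<And>i. 0 \<le> v i \<and> v i \<le> 1"
  obtains \<theta> where "\<theta> \<in> cube dd (-R) R"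
    "\<And>x. x \<in> cube d a b \<Longrightarrow> network d \<theta> \<tau> x = clip (mcshane d L v p x ((\<tau> - 2) div 2))"
proof -
  \<comment> \<open>If the last hidden layer is odd, the increment at \<open>d+1\<close> is still
    pending and the output layer adds it. After an even layer this position holds a positive part
    and gets weight 0.\<close>
  define W where "W l = (if l = 0 then even_weights d (1/2)
     else if l = \<tau> - 2 then (\<lambda>i j. (if j = d+1 then (if odd (\<tau> - 3) then 2 else 0) else 0) + (if j = 3*d+1 then 2 else 0))
     else if odd l then odd_weights d L else even_weights d 1)" for l
  define B where "B l = (if l = 0 then even_bias d (-a/2) 0 (p 0)
     else if l = \<tau> - 2 then (\<lambda>_. 0)
     else if odd l then odd_bias d (v (l div 2)) else even_bias d 0 a (p (l div 2)))" for l
  have pR: "\<bar>p i j\<bar> \<le> 2 * R" "\<bar>p i j - a\<bar> \<le> 2 * R" "\<bar>a - p i j\<bar> \<le> 2 * R" if "j \<in> {1..d}" for i j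
  proof -
    have "a \<le> p i j" "p i j \<le> b" using p[of i] that by (auto simp: cube_def PiE_def Pi_def)
    then show "\<bar>p i j\<bar> \<le> 2 * R" "\<bar>p i j - a\<bar> \<le> 2 * R" "\<bar>a - p i j\<bar> \<le> 2 * R"
      using R by linarith+
  qed
  have "\<bar>(if j = d+1 then (if odd (\<tau> - 3) then 2 else 0) else 0) + (if j = 3*d+1 then 2 else 0)\<bar> \<le> R" for j
    using R d by (intro two_weights_bound) auto
  then have WR: "\<bar>W l i j\<bar> \<le> R" for l i j
    using R d by (simp add: W_def even_weights_bound odd_weights_bound)
  have eb: "\<bar>even_bias d y0 a' (p i) k\<bar> \<le> R" if "\<bar>y0\<bar> \<le> R" "a' = 0 \<or> a' = a" for y0 a' i k
  proof -
    consider "k \<in> {1..d}" | "k \<notin> {1..d}" "k \<in> {d+1..2*d}" | "k \<notin> {1..d}" "k \<notin> {d+1..2*d}" "k \<in> {2*d+1..3*d}"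
      | "k \<notin> {1..d}" "k \<notin> {d+1..2*d}" "k \<notin> {2*d+1..3*d}" by blast
    then show ?thesis
    proof cases
      case 2
      then have "k - d \<in> {1..d}" by auto
      then have "\<bar>a' - p i (k - d)\<bar> \<le> 2 * R" using pR[of "k - d" i] that(2) by auto
      with 2 show ?thesis by (simp only: even_bias_def if_True if_False) simp
    next
      case 3
      then have "k - 2*d \<in> {1..d}" by auto
      then have "\<bar>p i (k - 2*d) - a'\<bar> \<le> 2 * R" using pR[of "k - 2*d" i] that(2) by auto
      with 3 show ?thesis by (simp only: even_bias_def if_True if_False) simp
    qed (use that R in \<open>simp_all only: even_bias_def if_True if_False\<close>)
  qed
  have BR: "\<bar>B l i\<bar> \<le> R" for l i
    using R v[of "l div 2"] by (auto simp: B_def odd_bias_def intro!: eb)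
  have \<tau>3: "3 \<le> \<tau>" "0 \<le> R" using \<tau> d R by auto
  obtain \<theta> where \<theta>: "\<theta> \<in> cube dd (-R) R"
    and first: "\<And>x. affine_map \<theta> 0 \<tau> d x = dense_layer \<tau> d (W 0) (B 0) x"
    and hidden: "\<And>l x. l < \<tau> - 3 \<Longrightarrow> affine_map \<theta> (\<tau> * (d + 1) + l * \<tau> * (\<tau> + 1)) \<tau> \<tau> x
       = dense_layer \<tau> \<tau> (W (l + 1)) (B (l + 1)) x"
    and out: "\<And>x. affine_map \<theta> (\<tau> * (d + 1) + (\<tau> - 3) * \<tau> * (\<tau> + 1)) 1 \<tau> x
       = dense_layer 1 \<tau> (W (\<tau> - 2)) (B (\<tau> - 2)) x"
    using network_weights_realizable[of \<tau> R W B, OF \<tau>3 WR BR D] by metis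
  have "network d \<theta> \<tau> x = clip (mcshane d L v p x ((\<tau> - 2) div 2))" if x: "x \<in> cube d a b" for x
  proof -
    have xa: "a \<le> x j" if "j \<in> {1..d}" for j using x that by (auto simp: cube_def PiE_def Pi_def)
    define G where "G = mcshane d L v p x"
    define w where "w i = max (v i / 2 - L * ((\<Sum>j=1..d. \<bar>x j - p i j\<bar>) / 2) - G i / 2) 0" for i
    have G0: "0 \<le> G i" for i unfolding G_def by (rule mcshane_nonneg)
    have Gw: "G i / 2 + w i = G (Suc i) / 2" for i by (simp add: G_def w_def max_def field_simps)
    \<comment> \<open>Conditional on the even state with the same index; the induction for
      \<open>even_step\<close> uses it to pass from \<open>i\<close> to
      \<open>Suc i\<close>.\<close>
    have odd_step: "relu_vec (hidden_out d \<theta> \<tau> (2 * i + 1) x) = odd_state d a x (w i) (G i / 2)"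
      if "2 * i + 1 \<le> \<tau> - 3" "relu_vec (hidden_out d \<theta> \<tau> (2 * i) x) = even_state d a x (p i) (G i / 2)" for i
    proof -
      have W: "W (2 * i + 1) = odd_weights d L" "B (2 * i + 1) = odd_bias d (v i)"
        using that(1) by (auto simp: W_def B_def)
      have "hidden_out d \<theta> \<tau> (2 * i + 1) x =
          dense_layer \<tau> \<tau> (odd_weights d L) (odd_bias d (v i)) (even_state d a x (p i) (G i / 2))"
        using hidden[of "2 * i" "even_state d a x (p i) (G i / 2)"] that unfolding W by simp
      then show ?thesis
        using relu_odd_layer[of d \<tau> a x "G i / 2" L "v i" "p i", OF \<tau> d xa] G0[of i]
        by (simp add: w_def)
    qed
    have even_step: "relu_vec (hidden_out d \<theta> \<tau> (2 * i) x) = even_state d a x (p i) (G i / 2)"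
      if "2 * i \<le> \<tau> - 3" for i
      using that
    proof (induction i)
      case 0
      have "relu_vec (dense_layer \<tau> d (even_weights d (1/2)) (even_bias d (-a/2) 0 (p 0)) x)
          = even_state d a x (p 0) 0"
      proof (rule relu_even_layer[OF \<tau> d order.refl _ xa])
        \<comment> \<open>The raw input has no coordinates \<open>d+1\<close> or
          \<open>3*d+1\<close>, so the last row yields the start value 0 of the maximum.\<close>
        show "(\<Sum>j=1..d. ((if j = d+1 then 1 else 0) + (if j = 3*d+1 then 1 else 0)) * x j) = 0"
          by (intro sum.neutral) auto
      qed (auto simp: field_simps)
      then show ?case by (simp add: first[simplified] W_def B_def G_def)
    next
      case (Suc i)
      have le: "2 * i + 1 \<le> \<tau> - 3" using Suc.prems by simp
      let ?S = "odd_state d a x (w i) (G i / 2)"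
      have S: "relu_vec (hidden_out d \<theta> \<tau> (2 * i + 1) x) = ?S"
        using odd_step[OF le] Suc.IH le by simp
      have W: "W (2 * i + 1 + 1) = even_weights d 1" "B (2 * i + 1 + 1) = even_bias d 0 a (p (Suc i))"
        using Suc.prems by (auto simp: W_def B_def)
      have "hidden_out d \<theta> \<tau> (2 * Suc i) x = dense_layer \<tau> \<tau> (even_weights d 1) (even_bias d 0 a (p (Suc i))) ?S"
        using hidden[of "2 * i + 1" ?S] Suc.prems S unfolding W by simp
      moreover have "relu_vec (dense_layer \<tau> \<tau> (even_weights d 1) (even_bias d 0 a (p (Suc i))) ?S)
          = even_state d a x (p (Suc i)) (G (Suc i) / 2)"
      proof (rule relu_even_layer[OF \<tau> d _ _ xa])
        have "(\<Sum>j=1..\<tau>. ((if j = d+1 then 1 else 0) + (if j = 3*d+1 then 1 else 0)) * ?S j) =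
            1 * ?S (d+1) + 1 * ?S (3*d+1)"
          unfolding distrib_right sum.distrib using \<tau> by (subst (1 2) sum_single_weight) auto
        also have "\<dots> = G (Suc i) / 2" using Gw[of i] d by (simp add: odd_state_def)
        finally show "(\<Sum>j=1..\<tau>. ((if j = d+1 then 1 else 0) + (if j = 3*d+1 then 1 else 0)) * ?S j) = G (Suc i) / 2" .
      qed (use \<tau> G0[of "Suc i"] in \<open>auto simp: odd_state_def field_simps\<close>)
      ultimately show ?case by simp
    qed
    let ?H = "relu_vec (hidden_out d \<theta> \<tau> (\<tau> - 3) x)"
    have ne: "\<tau> - 2 \<noteq> 0" using \<tau>3 by simp
    have "affine_map \<theta> (\<tau> * (d + 1) + (\<tau> - 3) * \<tau> * (\<tau> + 1)) 1 \<tau> ?H 1 =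
        (\<Sum>j=1..\<tau>. ((if j = d+1 then (if odd (\<tau> - 3) then 2 else 0) else 0) + (if j = 3*d+1 then 2 else 0)) * ?H j)"
      unfolding out using ne by (simp add: dense_layer_def W_def B_def)
    also have "\<dots> = (if odd (\<tau> - 3) then 2 else 0) * ?H (d+1) + 2 * ?H (3*d+1)"
      unfolding distrib_right sum.distrib using \<tau> by (subst (1 2) sum_single_weight) auto
    also have "\<dots> = G ((\<tau> - 2) div 2)"
    proof (cases "odd (\<tau> - 3)")
      case True
      then obtain i where i: "\<tau> - 3 = 2 * i + 1" by (rule oddE)
      then have "?H = odd_state d a x (w i) (G i / 2)" using odd_step[of i] even_step[of i] by simp
      moreover have "(\<tau> - 2) div 2 = Suc i" using i by simp
      ultimately show ?thesis using True Gw[of i] d by (simp add: odd_state_def)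
    next
      case False
      then have "even (\<tau> - 3)" by simp
      then obtain i where i: "\<tau> - 3 = 2 * i" by (rule evenE)
      then have "?H = even_state d a x (p i) (G i / 2)" using even_step[of i] by simp
      moreover have "\<tau> - 2 = 2 * i + 1" using i ne by simp
      then have "(\<tau> - 2) div 2 = i" by simp
      ultimately show ?thesis using False by (simp add: even_state_def)
    qed
    finally show ?thesis by (simp add: network_def G_def)
  qed
  with \<theta> that show ?thesis by blast
qed

section \<open>Approximation of Lipschitz functions\<close>

lemma eucl_dist_le_l1: "eucl_dist d x y \<le> (\<Sum>j=1..d. \<bar>x j - y j\<bar>)"
  using L2_set_le_sum_abs[of "\<lambda>j. x j - y j" "{1..d}"] by (simp add: eucl_dist_def L2_set_def)

text \<open>The McShane maximum lies below \<open>\<phi>\<close> by the Lipschitz condition. A grid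
  point near \<open>x\<close> limits the gap to \<open>2 * L\<close> times its l1 distance from
  \<open>x\<close>, which the grid width makes at most \<open>\<epsilon> / 2\<close>.\<close>

lemma network_approximation:
  fixes \<tau> dd d :: nat and L R a b \<epsilon> :: real
  assumes D: "\<tau> * (d + 1) + (\<tau> - 3) * \<tau> * (\<tau> + 1) + \<tau> + 1 \<le> dd"
    and d: "1 \<le> d" and ab: "a < b"
    and R: "2 \<le> R" "0 \<le> L" "L \<le> R" "\<bar>a\<bar> \<le> R" "\<bar>b\<bar> \<le> R"
    and range: "\<And>x. x \<in> cube d a b \<Longrightarrow> 0 \<le> \<phi> x \<and> \<phi> x \<le> 1"
    and lip: "\<And>x y. x \<in> cube d a b \<Longrightarrow> y \<in> cube d a b \<Longrightarrow> \<bar>\<phi> x - \<phi> y\<bar> \<le> L * eucl_dist d x y"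
    and \<epsilon>: "0 < \<epsilon>" and \<tau>: "2 * real d * (2 * real d * L * (b - a) / \<epsilon> + 2) ^ d \<le> real \<tau>"
  obtains \<theta> where "\<theta> \<in> cube dd (-R) R"
    "\<And>x. x \<in> cube d a b \<Longrightarrow> \<bar>network d \<theta> \<tau> x - \<phi> x\<bar> \<le> \<epsilon> / 2"
proof -
  define z where "z = 2 * real d * L * (b - a) / \<epsilon>"
  have z: "0 \<le> z" using R ab \<epsilon> by (simp add: z_def)
  \<comment> \<open>\<open>z \<le> n\<close> makes \<open>L\<close> times the l1 distance to a
    nearby grid point at most \<open>\<epsilon> / 4\<close>, and \<open>n + 1 \<le> z + 2\<close>
    matches the base in the hypothesis on \<open>\<tau>\<close>. The maximum with 1 covers
    \<open>z = 0\<close>.\<close>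
  define n where "n = max 1 (nat \<lceil>z\<rceil>)"
  have n: "1 \<le> n" "z \<le> real n" "real n \<le> z + 1" using z by (auto simp: n_def) linarith+
  obtain G where G: "finite G" "G \<noteq> {}" "G \<subseteq> cube d a b" "card G \<le> n ^ d"
    "\<And>x. x \<in> cube d a b \<Longrightarrow> \<exists>g\<in>G. \<forall>i\<in>{1..d}. \<bar>x i - g i\<bar> \<le> (b - a) / (2 * real n)"
    using cube_net_exists[OF ab n(1), of d] by metis
  define N where "N = card G"
  have N: "0 < N" using G by (simp add: N_def card_gt_0_iff)
  obtain h where h: "bij_betw h {0..<N} G"
    using ex_bij_betw_nat_finite[OF G(1)] unfolding N_def by auto
  \<comment> \<open>Cyclic repetition of the grid: the depth may admit more than \<open>N\<close>
    points, and the surplus layers then revisit old ones.\<close>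
  define p where "p i = h (i mod N)" for i
  have pG: "p i \<in> G" for i using h N by (auto simp: p_def bij_betw_def)
  have p: "p i \<in> cube d a b" for i using pG G(3) by auto
  have "real (n + 1) ^ d \<le> (z + 2) ^ d" using n z by (intro power_mono) auto
  then have "2 * real d * real (n + 1) ^ d \<le> 2 * real d * (z + 2) ^ d" by (rule mult_left_mono) simp
  then have "real (2 * d * (n + 1) ^ d) \<le> real \<tau>" using \<tau> unfolding z_def by simp
  then have \<tau>n: "2 * d * (n + 1) ^ d \<le> \<tau>" by (simp only: of_nat_le_iff)
  \<comment> \<open>Strictness yields \<open>N + 1\<close> in place of \<open>N\<close>, which pays
    for the 2 in \<open>(\<tau> - 2) div 2\<close>. With \<open>N \<ge> 1\<close> the same bound
    gives \<open>4 * d \<le> \<tau>\<close> and hence the width.\<close>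
  have "n ^ d < (n + 1) ^ d" using d by (intro power_strict_mono) auto
  then have "N + 1 \<le> (n + 1) ^ d" using G(4) by (simp add: N_def)
  then have "2 * (d * (N + 1)) \<le> \<tau>" using \<tau>n by (simp only: mult.assoc) (meson le_trans mult_le_mono2)
  moreover have "1 * (N + 1) \<le> d * (N + 1)" "d * 2 \<le> d * (N + 1)"
    using d N by (intro mult_right_mono mult_left_mono; simp)+
  ultimately have \<tau>N: "2 * (N + 1) \<le> \<tau>" "4 * d \<le> \<tau>" by linarith+
  then have NM: "N \<le> (\<tau> - 2) div 2" "3 * d + 1 \<le> \<tau>" using d by auto
  define M where "M = (\<tau> - 2) div 2"
  obtain \<theta> where \<theta>: "\<theta> \<in> cube dd (-R) R"
    "\<And>x. x \<in> cube d a b \<Longrightarrow> network d \<theta> \<tau> x = clip (mcshane d L (\<lambda>i. \<phi> (p i)) p x M)"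
    using mcshane_network[of \<tau> d dd R L a b p "\<lambda>i. \<phi> (p i)", OF D NM(2) d R p range[OF p]]
    unfolding M_def by metis
  have lip1: "\<bar>\<phi> x - \<phi> y\<bar> \<le> L * (\<Sum>j=1..d. \<bar>x j - y j\<bar>)" if "x \<in> cube d a b" "y \<in> cube d a b" for x y
    using lip[OF that] mult_left_mono[OF eucl_dist_le_l1 R(2)] by (rule order.trans)
  have "\<bar>network d \<theta> \<tau> x - \<phi> x\<bar> \<le> \<epsilon> / 2" if x: "x \<in> cube d a b" for x
  proof -
    let ?m = "mcshane d L (\<lambda>i. \<phi> (p i)) p x M"
    have "\<phi> (p i) - L * (\<Sum>j=1..d. \<bar>x j - p i j\<bar>) \<le> \<phi> x" for i
      using lip1[OF x p[of i]] by linarith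
    then have up: "?m \<le> \<phi> x" using range[OF x] by (intro mcshane_le) auto
    then have "clip ?m = ?m" using mcshane_nonneg[of d L "\<lambda>i. \<phi> (p i)" p x M] range[OF x]
      by (simp add: clip_def)
    moreover have "\<phi> x - \<epsilon> / 2 \<le> ?m"
    proof -
      obtain g where g: "g \<in> G" "\<forall>i\<in>{1..d}. \<bar>x i - g i\<bar> \<le> (b - a) / (2 * real n)"
        using G(5)[OF x] by auto
      obtain i where i: "i < N" "h i = g" using h g(1) by (auto simp: bij_betw_def)
      then have pi: "p i = g" by (simp add: p_def)
      have "(\<Sum>j=1..d. \<bar>x j - g j\<bar>) \<le> (\<Sum>j=1..d. (b - a) / (2 * real n))"
        using g(2) by (intro sum_mono) auto
      then have "L * (\<Sum>j=1..d. \<bar>x j - g j\<bar>) \<le> L * (real d * ((b - a) / (2 * real n)))"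
        using R(2) by (intro mult_left_mono) auto
      also have "\<dots> = z * \<epsilon> / (4 * real n)" using \<epsilon> n(1) by (simp add: z_def field_simps)
      also have "\<dots> \<le> \<epsilon> / 4" using n \<epsilon> by (simp add: field_simps mult_right_mono)
      finally have "L * (\<Sum>j=1..d. \<bar>x j - g j\<bar>) \<le> \<epsilon> / 4" .
      moreover have "\<phi> g - L * (\<Sum>j=1..d. \<bar>x j - g j\<bar>) \<le> ?m"
        using mcshane_ge[where i = i and n = M and v = "\<lambda>i. \<phi> (p i)" and L = L and d = d and x = x and p = p] i NM(1) pi by (simp add: M_def)
      moreover have "\<bar>\<phi> x - \<phi> g\<bar> \<le> L * (\<Sum>j=1..d. \<bar>x j - g j\<bar>)"
        using lip1[OF x] g(1) G(3) by auto
      ultimately show ?thesis by linarith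
    qed
    ultimately show ?thesis using \<theta>(2)[OF x] up by simp
  qed
  with \<theta>(1) that show ?thesis by blast
qed

section \<open>Measurability and concentration\<close>

lemma measurable_coordinate: "j \<in> {1..d} \<Longrightarrow> (\<lambda>x. x j) \<in> borel_measurable (Rn d)"
  using measurable_component_singleton[of j "{1..d}" "\<lambda>_. lborel :: real measure"] by simp

lemma affine_map_measurable:
  assumes "\<And>j. j \<in> {1..s} \<Longrightarrow> (\<lambda>x. g x j) \<in> borel_measurable N"
  shows "(\<lambda>x. affine_map \<theta> k r s (g x) i) \<in> borel_measurable N"
proof (cases "i \<in> {1..r}")
  case True
  have "(\<lambda>x. (\<Sum>j=1..s. \<theta> (k + (i - 1) * s + j) * g x j) + \<theta> (k + r * s + i)) \<in> borel_measurable N"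
    by (intro borel_measurable_add borel_measurable_sum borel_measurable_times borel_measurable_const assms)
  with True show ?thesis by (simp only: affine_map_def if_True)
next
  case False
  then show ?thesis by (simp only: affine_map_def if_False borel_measurable_const)
qed

lemma hidden_out_measurable: "(\<lambda>x. hidden_out d \<theta> \<tau> j x i) \<in> borel_measurable (Rn d)"
proof (induction j arbitrary: i)
  case 0
  show ?case unfolding hidden_out.simps by (intro affine_map_measurable measurable_coordinate)
next
  case (Suc j)
  show ?case
    unfolding hidden_out.simps relu_vec_def
    by (intro affine_map_measurable borel_measurable_max borel_measurable_const Suc.IH)
qed

lemma network_measurable: "(\<lambda>x. network d \<theta> \<tau> x) \<in> borel_measurable (Rn d)"
  unfolding network_def clip_def relu_vec_def
  by (intro borel_measurable_min borel_measurable_max borel_measurable_const affine_map_measurable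
      hidden_out_measurable)

lemma network_range: "0 \<le> network d \<theta> \<tau> x \<and> network d \<theta> \<tau> x \<le> 1"
  by (simp add: network_def clip_def)

lemma cube_measurable: "cube n lo hi \<in> sets (Rn n)"
  unfolding cube_def by (intro sets_PiM_I_finite) auto

text \<open>On the cube \<open>\<phi>\<close> is a pointwise limit of networks supplied by
  \<open>network_approximation\<close>, and each of these is measurable for the product
  sigma-algebra by its construction.\<close>

lemma lipschitz_on_cube_measurable:
  assumes d: "1 \<le> d" and ab: "a < b" and L: "0 \<le> L"
    and range: "\<And>x. x \<in> cube d a b \<Longrightarrow> 0 \<le> \<phi> x \<and> \<phi> x \<le> 1"
    and lip: "\<And>x y. x \<in> cube d a b \<Longrightarrow> y \<in> cube d a b \<Longrightarrow> \<bar>\<phi> x - \<phi> y\<bar> \<le> L * eucl_dist d x y"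
  shows "(\<lambda>x. indicator (cube d a b) x * \<phi> x) \<in> borel_measurable (Rn d)"
proof -
  define R where "R = Max {2, L, \<bar>a\<bar>, \<bar>b\<bar>}"
  have R: "2 \<le> R" "L \<le> R" "\<bar>a\<bar> \<le> R" "\<bar>b\<bar> \<le> R" unfolding R_def by (intro Max_ge; simp)+
  have "\<exists>\<theta> \<tau>. \<forall>x\<in>cube d a b. \<bar>network d \<theta> \<tau> x - \<phi> x\<bar> \<le> inverse (real (Suc k))" for k
  proof -
    let ?\<epsilon> = "2 * inverse (real (Suc k))"
    obtain \<tau> :: nat where "2 * real d * (2 * real d * L * (b - a) / ?\<epsilon> + 2) ^ d \<le> real \<tau>"
      using real_arch_simple by blast
    moreover have "0 < ?\<epsilon>" by simp
    ultimately obtain \<theta> where "\<And>x. x \<in> cube d a b \<Longrightarrow> \<bar>network d \<theta> \<tau> x - \<phi> x\<bar> \<le> ?\<epsilon> / 2"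
      using network_approximation[OF order.refl d ab R(1) L R(2-4) range lip, of ?\<epsilon> \<tau>] by blast
    moreover have "?\<epsilon> / 2 = inverse (real (Suc k))" by simp
    ultimately show ?thesis by (intro exI[of _ \<theta>] exI[of _ \<tau>] ballI) (simp only:)
  qed
  then obtain \<theta> \<tau> where \<theta>: "\<And>k x. x \<in> cube d a b \<Longrightarrow> \<bar>network d (\<theta> k) (\<tau> k) x - \<phi> x\<bar> \<le> inverse (real (Suc k))"
    by metis
  show ?thesis
  proof (rule borel_measurable_LIMSEQ_real)
    show "(\<lambda>x. indicator (cube d a b) x * network d (\<theta> k) (\<tau> k) x) \<in> borel_measurable (Rn d)" for k
      by (intro borel_measurable_times borel_measurable_indicator cube_measurable network_measurable)
    fix x
    show "(\<lambda>k. indicator (cube d a b) x * network d (\<theta> k) (\<tau> k) x) \<longlonglongrightarrow> indicator (cube d a b) x * \<phi> x"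
    proof (cases "x \<in> cube d a b")
      case True
      have "(\<lambda>k. network d (\<theta> k) (\<tau> k) x - \<phi> x) \<longlonglongrightarrow> 0"
        using \<theta>[OF True] by (intro Lim_null_comparison[OF _ LIMSEQ_inverse_real_of_nat]) auto
      then show ?thesis using True by (simp add: LIM_zero_iff)
    qed simp
  qed
qed

section \<open>Concentration and hitting probabilities for i.i.d. samples\<close>

lemma (in prob_space) iid_empirical_mean_deviation:
  assumes X: "indep_vars (\<lambda>_. N) X {1..}"
    and id: "\<And>m. 1 \<le> m \<Longrightarrow> distr M N (X m) = distr M N (X 1)"
    and f: "f \<in> borel_measurable N" "\<And>x. x \<in> space N \<Longrightarrow> 0 \<le> f x \<and> f x \<le> 1"
    and n: "1 \<le> (n :: nat)" and t: "(0 :: real) \<le> t"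
  shows "prob {\<omega> \<in> space M. t \<le> \<bar>1 / real n * (\<Sum>m=1..n. f (X m \<omega>)) - expectation (\<lambda>\<omega>. f (X 1 \<omega>))\<bar>}
    \<le> 2 * exp (- 2 * real n * t\<^sup>2)"
proof -
  have rv: "X m \<in> measurable M N" if "1 \<le> m" for m
    using X that by (auto simp: indep_vars_def)
  have ne: "{1..n} \<noteq> {}" and card: "card {1..n} = n" using n by auto
  interpret Hoeffding_ineq_iid M "{1..n}" "\<lambda>m \<omega>. f (X m \<omega>)" "\<lambda>\<omega>. f (X 1 \<omega>)" 0 1
    "expectation (\<lambda>\<omega>. f (X 1 \<omega>))"
  proof unfold_locales
    show "finite {1..n}" by simp
    show "indep_vars (\<lambda>_. borel) (\<lambda>m \<omega>. f (X m \<omega>)) {1..n}"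
      by (rule indep_vars_compose2[OF indep_vars_subset[OF X]]) (use f in auto)
    show "distr M borel (\<lambda>\<omega>. f (X m \<omega>)) = distr M borel (\<lambda>\<omega>. f (X 1 \<omega>))" if "m \<in> {1..n}" for m
    proof -
      have "distr M borel (\<lambda>\<omega>. f (X i \<omega>)) = distr (distr M N (X i)) borel f" if "1 \<le> i" for i
        using distr_distr[OF f(1) rv[OF that]] by (simp add: comp_def)
      from this[of m] this[of 1] show ?thesis using id[of m] that by simp
    qed
    show "(\<lambda>\<omega>. f (X 1 \<omega>)) \<in> borel_measurable M"
      using measurable_compose[OF rv f(1)] by simp
    show "AE \<omega> in M. f (X 1 \<omega>) \<in> {0..1}"
      using f(2) measurable_space[OF rv[of 1]] by (intro AE_I2) auto
  qed
  from Hoeffding_ineq_abs_ge'[OF t zero_less_one ne] show ?thesis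
    by (simp only: card diff_zero one_power2 div_by_1 times_divide_eq_left mult_1_left)
qed

text \<open>By independence, \<open>K\<close> misses have probability at most
  \<open>(1 - p) ^ K\<close>, and \<open>1 - p \<le> exp (- p)\<close>.\<close>

lemma (in prob_space) iid_no_hit:
  assumes Y: "indep_vars (\<lambda>_. N) Y {1..}"
    and id: "\<And>m. 1 \<le> m \<Longrightarrow> distr M N (Y m) = distr M N (Y 1)"
    and A: "A \<in> sets N" and p: "0 \<le> p" "p \<le> measure (distr M N (Y 1)) A" and K: "1 \<le> (K :: nat)"
  shows "{\<omega> \<in> space M. \<forall>k\<in>{1..K}. Y k \<omega> \<notin> A} \<in> events"
    and "prob {\<omega> \<in> space M. \<forall>k\<in>{1..K}. Y k \<omega> \<notin> A} \<le> exp (- (real K * p))"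
proof -
  have rv: "Y m \<in> measurable M N" if "1 \<le> m" for m
    using Y that by (auto simp: indep_vars_def)
  have eq: "{\<omega> \<in> space M. \<forall>k\<in>{1..K}. Y k \<omega> \<notin> A} = (\<Inter>k\<in>{1..K}. Y k -` (space N - A) \<inter> space M)"
    using K measurable_space[OF rv] by fastforce
  show "{\<omega> \<in> space M. \<forall>k\<in>{1..K}. Y k \<omega> \<notin> A} \<in> events"
    unfolding eq using K rv A by (intro sets.finite_INT measurable_sets) auto
  have one: "prob (Y k -` (space N - A) \<inter> space M) \<le> 1 - p" if "1 \<le> k" for k
  proof -
    interpret D: prob_space "distr M N (Y 1)" by (rule prob_space_distr[OF rv]) simp
    have "prob (Y k -` (space N - A) \<inter> space M) = measure (distr M N (Y k)) (space N - A)"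
      using rv[OF that] A by (simp add: measure_distr)
    also have "\<dots> = 1 - measure (distr M N (Y 1)) A"
      using D.prob_compl[of A] A id[OF that] by simp
    finally show ?thesis using p by simp
  qed
  have "prob {\<omega> \<in> space M. \<forall>k\<in>{1..K}. Y k \<omega> \<notin> A} = (\<Prod>k=1..K. prob (Y k -` (space N - A) \<inter> space M))"
    unfolding eq using K A by (intro indep_varsD[OF Y]) auto
  also have "\<dots> \<le> (\<Prod>k=1..K. exp (- p))"
    using one exp_ge_add_one_self[of "-p"] by (intro prod_mono) (auto intro: order.trans)
  also have "\<dots> = exp (- (real K * p))" by (simp add: exp_of_nat_mult[symmetric])
  finally show "prob {\<omega> \<in> space M. \<forall>k\<in>{1..K}. Y k \<omega> \<notin> A} \<le> exp (- (real K * p))" .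
qed

section \<open>Volumes of boxes in the parameter cube\<close>

lemma emeasure_box:
  assumes "\<And>i. i \<in> {1..n} \<Longrightarrow> l i \<le> u i"
  shows "emeasure (Rn n) (PiE {1..n} (\<lambda>i. {l i..u i})) = ennreal (\<Prod>i=1..n. u i - l i)"
proof -
  interpret product_sigma_finite "\<lambda>_ :: nat. lborel :: real measure" by unfold_locales
  have "emeasure (Rn n) (PiE {1..n} (\<lambda>i. {l i..u i})) = (\<Prod>i=1..n. emeasure lborel {l i..u i})"
    by (rule emeasure_PiM) auto
  also have "\<dots> = (\<Prod>i=1..n. ennreal (u i - l i))" using assms by (intro prod.cong) auto
  also have "\<dots> = ennreal (\<Prod>i=1..n. u i - l i)" using assms by (intro prod_ennreal) auto
  finally show ?thesis .
qed

text \<open>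
  Each side of this box has length at least \<open>\<delta>\<close> even if \<open>\<theta>\<close> lies on the boundary of the parameter cube.
\<close>

definition sub_box :: "nat \<Rightarrow> real \<Rightarrow> (nat \<Rightarrow> real) \<Rightarrow> real \<Rightarrow> (nat \<Rightarrow> real) set" where
  "sub_box n R \<theta> \<delta> = PiE {1..n} (\<lambda>i. {max (-R) (\<theta> i - \<delta>)..min R (\<theta> i + \<delta>)})"

lemma sub_box_measurable: "sub_box n R \<theta> \<delta> \<in> sets (Rn n)"
  unfolding sub_box_def by (intro sets_PiM_I_finite) auto

text \<open>A ratio of volumes: \<open>n\<close> sides of length at least \<open>\<delta>\<close>
  against \<open>n\<close> sides of length \<open>2 * R\<close>.\<close>

lemma uniform_measure_sub_box_ge:
  assumes \<theta>: "\<theta> \<in> cube n (-R) R" and \<delta>: "0 < \<delta>" "\<delta> \<le> R"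
  shows "(\<delta> / (2 * R)) ^ n \<le> measure (uniform_measure (Rn n) (cube n (-R) R)) (sub_box n R \<theta> \<delta>)"
proof -
  have len: "\<delta> \<le> min R (\<theta> i + \<delta>) - max (-R) (\<theta> i - \<delta>)" if "i \<in> {1..n}" for i
    using cube_D[OF \<theta> that] \<delta> by (auto simp: min_def max_def)
  have le: "max (-R) (\<theta> i - \<delta>) \<le> min R (\<theta> i + \<delta>)" if "i \<in> {1..n}" for i
    using len[OF that] \<delta> by linarith
  have cube: "emeasure (Rn n) (cube n (-R) R) = ennreal ((2 * R) ^ n)"
    unfolding cube_def using \<delta> by (subst emeasure_box) auto
  define V where "V = (\<Prod>i=1..n. min R (\<theta> i + \<delta>) - max (-R) (\<theta> i - \<delta>))"
  have V0: "0 \<le> V" unfolding V_def using le by (intro prod_nonneg) simp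
  have box: "emeasure (Rn n) (sub_box n R \<theta> \<delta>) = ennreal V"
    unfolding sub_box_def V_def using le by (rule emeasure_box)
  have sub: "sub_box n R \<theta> \<delta> \<subseteq> cube n (-R) R" unfolding sub_box_def cube_def by (intro PiE_mono) auto
  have "emeasure (uniform_measure (Rn n) (cube n (-R) R)) (sub_box n R \<theta> \<delta>)
      = emeasure (Rn n) (cube n (-R) R \<inter> sub_box n R \<theta> \<delta>) / emeasure (Rn n) (cube n (-R) R)"
    by (rule emeasure_uniform_measure[OF cube_measurable sub_box_measurable])
  also have "cube n (-R) R \<inter> sub_box n R \<theta> \<delta> = sub_box n R \<theta> \<delta>" using sub by blast
  finally have "emeasure (uniform_measure (Rn n) (cube n (-R) R)) (sub_box n R \<theta> \<delta>)
      = emeasure (Rn n) (sub_box n R \<theta> \<delta>) / emeasure (Rn n) (cube n (-R) R)" .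
  moreover have "emeasure (Rn n) (sub_box n R \<theta> \<delta>) / emeasure (Rn n) (cube n (-R) R) = ennreal (V / (2 * R) ^ n)"
    unfolding cube box by (rule divide_ennreal[OF V0]) (use \<delta> in simp)
  moreover have VR: "0 \<le> V / (2 * R) ^ n" using V0 \<delta> by simp
  ultimately have "measure (uniform_measure (Rn n) (cube n (-R) R)) (sub_box n R \<theta> \<delta>) = V / (2 * R) ^ n"
    using VR unfolding measure_def by (simp only: enn2real_ennreal)
  moreover have "(\<Prod>i=1..n. \<delta>) \<le> V"
    unfolding V_def using len \<delta> by (intro prod_mono) simp
  ultimately show ?thesis using \<delta> by (simp add: power_divide divide_right_mono)
qed

text \<open>The minimum of finitely many risks is attained, so \<open>LEAST\<close> ranges over a
  nonempty set and returns an actual minimizer.\<close>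

lemma selected_param_minimizes:
  assumes "1 \<le> K"
  shows "\<exists>k\<in>{1..K}. selected_param d X \<phi> Theta dd K M \<tau> \<omega> = Theta dd k \<omega>"
    and "j \<in> {1..K} \<Longrightarrow> emp_risk d X \<phi> M \<tau> (selected_param d X \<phi> Theta dd K M \<tau> \<omega>) \<omega>
      \<le> emp_risk d X \<phi> M \<tau> (Theta dd j \<omega>) \<omega>"
proof -
  let ?r = "\<lambda>k. emp_risk d X \<phi> M \<tau> (Theta dd k \<omega>) \<omega>"
  let ?Q = "\<lambda>k. k \<in> {1..K} \<and> ?r k = Min (?r ` {1..K})"
  have "Min (?r ` {1..K}) \<in> ?r ` {1..K}" using assms by (intro Min_in) auto
  then have "\<exists>k. ?Q k" by auto
  then have Q: "?Q (LEAST k. ?Q k)" by (rule LeastI_ex)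
  show "\<exists>k\<in>{1..K}. selected_param d X \<phi> Theta dd K M \<tau> \<omega> = Theta dd k \<omega>"
    using Q unfolding selected_param_def by blast
  show "?r j \<ge> emp_risk d X \<phi> M \<tau> (selected_param d X \<phi> Theta dd K M \<tau> \<omega>) \<omega>" if "j \<in> {1..K}"
    using Q that unfolding selected_param_def by simp
qed

section \<open>The error estimate\<close>

text \<open>Two opposite corners of the cube are distinct since \<open>1 \<le> d\<close> and
  \<open>a < b\<close>; the Lipschitz condition for them forces the sign of
  \<open>L\<close>.\<close>

lemma lipschitz_constant_nonneg:
  assumes d: "1 \<le> d" and ab: "a < b"
    and lip: "\<And>x y. x \<in> cube d a b \<Longrightarrow> y \<in> cube d a b \<Longrightarrow> \<bar>\<phi> x - \<phi> y\<bar> \<le> L * eucl_dist d x y"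
  shows "0 \<le> L"
proof -
  let ?x = "restrict (\<lambda>_. a) {1..d}" and ?y = "restrict (\<lambda>_. b) {1..d}"
  have "0 \<le> L * eucl_dist d ?x ?y"
    using lip[of ?x ?y] ab by (force simp: cube_def)
  moreover have "eucl_dist d ?x ?y = sqrt (\<Sum>i=1..d. (a - b)\<^sup>2)"
    unfolding eucl_dist_def by (intro arg_cong[where f = sqrt] sum.cong) auto
  then have "0 < eucl_dist d ?x ?y" using d ab by simp
  ultimately show ?thesis by (simp add: zero_le_mult_iff)
qed

lemma abs_square_diff_le:
  fixes u v :: real
  assumes "\<bar>u\<bar> \<le> 1" "\<bar>v\<bar> \<le> 1"
  shows "\<bar>\<bar>u\<bar>\<^sup>2 - \<bar>v\<bar>\<^sup>2\<bar> \<le> 2 * \<bar>u - v\<bar>"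
proof -
  have "\<bar>u\<bar>\<^sup>2 - \<bar>v\<bar>\<^sup>2 = (u + v) * (u - v)" by (simp add: power2_eq_square algebra_simps)
  then have "\<bar>\<bar>u\<bar>\<^sup>2 - \<bar>v\<bar>\<^sup>2\<bar> = \<bar>u + v\<bar> * \<bar>u - v\<bar>" by (simp add: abs_mult)
  also have "\<dots> \<le> 2 * \<bar>u - v\<bar>" using assms by (intro mult_right_mono) auto
  finally show ?thesis .
qed

text \<open>Explains the final constant: \<open>34 * R\<^sup>2 * \<tau>\<close> is
  \<open>17 * R\<close> times \<open>2 * R * \<tau>\<close>, so its \<open>\<tau>\<close>-th power
  covers the Lipschitz constant of the network together with the factor \<open>17 * R\<close> from
  the size of the net.\<close>

lemma scaled_power_ge:
  fixes R :: real
  assumes "1 \<le> R" "1 \<le> \<tau>"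
  shows "17 * R * (2 * R * real \<tau>) ^ \<tau> \<le> (34 * R\<^sup>2 * real \<tau>) ^ \<tau>"
proof -
  have "34 * R\<^sup>2 * real \<tau> = (17 * R) * (2 * R * real \<tau>)" by (simp add: power2_eq_square)
  then have "(34 * R\<^sup>2 * real \<tau>) ^ \<tau> = (17 * R) ^ \<tau> * (2 * R * real \<tau>) ^ \<tau>"
    by (simp only: power_mult_distrib)
  moreover have "17 * R \<le> (17 * R) ^ \<tau>" using assms by (intro self_le_power) auto
  ultimately show ?thesis using assms by (simp add: mult_right_mono)
qed

lemma (in prob_space) expectation_abs_le:
  fixes Y :: "'a \<Rightarrow> real"
  assumes Y: "Y \<in> borel_measurable M" "\<And>\<omega>. \<omega> \<in> space M \<Longrightarrow> \<bar>Y \<omega>\<bar> \<le> 1" and \<epsilon>: "0 < \<epsilon>"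
    and sq: "expectation (\<lambda>\<omega>. \<bar>Y \<omega>\<bar>\<^sup>2) \<le> \<epsilon>\<^sup>2"
  shows "expectation (\<lambda>\<omega>. \<bar>Y \<omega>\<bar>) \<le> \<epsilon>"
proof -
  have i: "integrable M (\<lambda>\<omega>. \<bar>Y \<omega>\<bar>\<^sup>2)" "integrable M (\<lambda>\<omega>. \<bar>Y \<omega>\<bar>)"
    using Y by (auto intro!: integrable_const_bound[where B = 1] simp: abs_square_le_1)
  \<comment> \<open>Young's inequality replaces Jensen's inequality here.\<close>
  have "y \<le> y\<^sup>2 / (2 * \<epsilon>) + \<epsilon> / 2" for y
  proof -
    have "0 \<le> (y - \<epsilon>)\<^sup>2 / (2 * \<epsilon>)" using \<epsilon> by simp
    also have "\<dots> = y\<^sup>2 / (2 * \<epsilon>) + \<epsilon> / 2 - y"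
      using \<epsilon> by (simp add: field_simps power2_eq_square)
    finally show ?thesis by simp
  qed
  from this[of "\<bar>Y \<omega>\<bar>" for \<omega>] have "expectation (\<lambda>\<omega>. \<bar>Y \<omega>\<bar>) \<le> expectation (\<lambda>\<omega>. \<bar>Y \<omega>\<bar>\<^sup>2 / (2 * \<epsilon>) + \<epsilon> / 2)"
    using i by (intro integral_mono) auto
  also have "\<dots> = expectation (\<lambda>\<omega>. \<bar>Y \<omega>\<bar>\<^sup>2) / (2 * \<epsilon>) + \<epsilon> / 2"
    using i by (simp add: prob_space)
  also have "\<dots> \<le> \<epsilon>\<^sup>2 / (2 * \<epsilon>) + \<epsilon> / 2" using sq \<epsilon> by (simp add: divide_right_mono)
  also have "\<dots> = \<epsilon>" using \<epsilon> by (simp add: power2_eq_square)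
  finally show ?thesis .
qed

theorem theorem1p1:
  fixes d :: nat and L a b R :: real
    and P :: "'a measure"
    and X :: "nat \<Rightarrow> 'a \<Rightarrow> (nat \<Rightarrow> real)"
    and \<phi> :: "(nat \<Rightarrow> real) \<Rightarrow> real"
    and Theta :: "nat \<Rightarrow> nat \<Rightarrow> 'a \<Rightarrow> (nat \<Rightarrow> real)"
  assumes d_pos: "d \<ge> 1"
    and ab: "a < b"
    and R_ge: "R \<ge> Max {2, L, \<bar>a\<bar>, \<bar>b\<bar>}"
    and P: "prob_space P"
    and X_indep: "prob_space.indep_vars P (\<lambda>_. Rn d) X {1..}"
    and X_id: "\<And>m. m \<ge> 1 \<Longrightarrow> distr P (Rn d) (X m) = distr P (Rn d) (X 1)"
    and X_range: "\<And>m \<omega>. m \<ge> 1 \<Longrightarrow> \<omega> \<in> space P \<Longrightarrow> X m \<omega> \<in> cube d a b"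
    and \<phi>_range: "\<And>x. x \<in> cube d a b \<Longrightarrow> 0 \<le> \<phi> x \<and> \<phi> x \<le> 1"
    and \<phi>_lip: "\<And>x y. x \<in> cube d a b \<Longrightarrow> y \<in> cube d a b \<Longrightarrow>
                  \<bar>\<phi> x - \<phi> y\<bar> \<le> L * eucl_dist d x y"
    and Theta_indep: "\<And>dd. dd \<ge> 1 \<Longrightarrow> prob_space.indep_vars P (\<lambda>_. Rn dd) (Theta dd) {1..}"
    and Theta_id: "\<And>dd k. dd \<ge> 1 \<Longrightarrow> k \<ge> 1 \<Longrightarrow>
                    distr P (Rn dd) (Theta dd k) = distr P (Rn dd) (Theta dd 1)"
    and Theta_range: "\<And>dd k \<omega>. dd \<ge> 1 \<Longrightarrow> k \<ge> 1 \<Longrightarrow> \<omega> \<in> space P \<Longrightarrow>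
                    Theta dd k \<omega> \<in> cube dd (-R) R"
    and Theta_unif: "\<And>dd. dd \<ge> 1 \<Longrightarrow>
                    distr P (Rn dd) (Theta dd 1) = uniform_measure (Rn dd) (cube dd (-R) R)"
  shows "\<exists>c::real. c > 0 \<and>
    (\<forall>dd K M \<tau> :: nat. \<forall>\<epsilon>::real.
       dd \<ge> 1 \<and> K \<ge> 1 \<and> M \<ge> 1 \<and> \<tau> \<ge> 1 \<and> 0 < \<epsilon> \<and> \<epsilon> \<le> 1 \<and>
       real \<tau> \<ge> 2 * real d * (2 * real d * L * (b - a) / \<epsilon> + 2) ^ d \<and>
       dd \<ge> \<tau> * (d + 1) + (\<tau> - 3) * \<tau> * (\<tau> + 1) + \<tau> + 1
       \<longrightarrow>
       measure P {\<omega> \<in> space P.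
          set_lebesgue_integral (distr P (Rn d) (X 1)) (cube d a b)
            (\<lambda>x. \<bar>network d (selected_param d X \<phi> Theta dd K M \<tau> \<omega>) \<tau> x - \<phi> x\<bar>) > \<epsilon>}
       \<le> exp (- (real K * \<epsilon> ^ (2 * dd) / (c * real \<tau>) ^ (\<tau> * dd)))
         + 2 * exp (real dd * ln ((c * real \<tau>) ^ \<tau> / \<epsilon>^2) - \<epsilon>^4 * real M / c))"
proof -
  interpret prob_space P by (rule P)
  have R: "2 \<le> R" "L \<le> R" "\<bar>a\<bar> \<le> R" "\<bar>b\<bar> \<le> R"
    using R_ge by (auto simp: Max_ge_iff Max_le_iff)
  have L0: "0 \<le> L" using lipschitz_constant_nonneg[OF d_pos ab \<phi>_lip] .
  have rvX: "X m \<in> measurable P (Rn d)" if "1 \<le> m" for m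
    using X_indep that by (auto simp: indep_vars_def)
  have \<phi>m: "(\<lambda>x. indicator (cube d a b) x * \<phi> x) \<in> borel_measurable (Rn d)"
    by (rule lipschitz_on_cube_measurable[OF d_pos ab L0 \<phi>_range \<phi>_lip])
  \<comment> \<open>Both terms carry the indicator because \<open>\<phi>\<close> is controlled on
    the cube only. This makes \<open>e\<close> measurable and bounded by 1 on the whole space, while
    at the samples it is the true error.\<close>
  define e where "e \<theta> \<tau> x = indicator (cube d a b) x * network d \<theta> \<tau> x - indicator (cube d a b) x * \<phi> x" for \<theta> \<tau> x
  have em: "e \<theta> \<tau> \<in> borel_measurable (Rn d)" for \<theta> \<tau>
    unfolding e_def
    by (intro borel_measurable_diff \<phi>m borel_measurable_times borel_measurable_indicator cube_measurable network_measurable)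
  have e_cube: "e \<theta> \<tau> x = network d \<theta> \<tau> x - \<phi> x" if "x \<in> cube d a b" for \<theta> \<tau> x
    using that by (simp add: e_def)
  have e1: "\<bar>e \<theta> \<tau> x\<bar> \<le> 1" for \<theta> \<tau> x
  proof (cases "x \<in> cube d a b")
    case True
    then show ?thesis
      using \<phi>_range[OF True] network_range[of d \<theta> \<tau> x] unfolding e_cube[OF True] by linarith
  qed (simp add: e_def)
  define f where "f \<theta> \<tau> x = \<bar>e \<theta> \<tau> x\<bar>\<^sup>2" for \<theta> \<tau> x
  have fm: "f \<theta> \<tau> \<in> borel_measurable (Rn d)" for \<theta> \<tau>
    unfolding f_def by (intro borel_measurable_power borel_measurable_abs em)
  have f01: "0 \<le> f \<theta> \<tau> x" "f \<theta> \<tau> x \<le> 1" for \<theta> \<tau> x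
    using e1[of \<theta> \<tau> x] by (auto simp: f_def abs_square_le_1)
  have emp: "emp_risk d X \<phi> M \<tau> \<theta> \<omega> = 1 / real M * (\<Sum>m=1..M. f \<theta> \<tau> (X m \<omega>))" if "\<omega> \<in> space P" for M \<tau> \<theta> \<omega>
    unfolding emp_risk_def f_def using e_cube[OF X_range] that by simp
  define E where "E \<theta> \<tau> = expectation (\<lambda>\<omega>. f \<theta> \<tau> (X 1 \<omega>))" for \<theta> \<tau>
  have X1m: "(\<lambda>\<omega>. g (X 1 \<omega>)) \<in> borel_measurable P" if "g \<in> borel_measurable (Rn d)" for g :: "_ \<Rightarrow> real"
    using measurable_compose[OF rvX that] by simp
  have fint: "integrable P (\<lambda>\<omega>. f \<theta> \<tau> (X 1 \<omega>))" for \<theta> \<tau>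
    using f01 by (intro integrable_const_bound[where B = 1] X1m fm) auto
  have L1_error: "set_lebesgue_integral (distr P (Rn d) (X 1)) (cube d a b) (\<lambda>x. \<bar>network d \<theta> \<tau> x - \<phi> x\<bar>)
      = expectation (\<lambda>\<omega>. \<bar>e \<theta> \<tau> (X 1 \<omega>)\<bar>)" for \<theta> \<tau>
  proof -
    have "indicator (cube d a b) x *\<^sub>R \<bar>network d \<theta> \<tau> x - \<phi> x\<bar> = \<bar>e \<theta> \<tau> x\<bar>" for x
      by (cases "x \<in> cube d a b") (simp_all add: e_def)
    then show ?thesis
      unfolding set_lebesgue_integral_def
      using integral_distr[OF rvX borel_measurable_abs[OF em]] by simp
  qed
  \<comment> \<open>The value fits \<open>scaled_power_ge\<close>; that it is at least 8 serves the
    Hoeffding exponent.\<close>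
  define c where "c = 34 * R\<^sup>2"
  have c8: "8 \<le> c" using power_mono[of 2 R 2] R by (simp add: c_def)
  show ?thesis
  proof (intro exI[of _ c] conjI allI impI)
    show "0 < c" using c8 by simp
    fix dd K M \<tau> :: nat and \<epsilon> :: real
    assume "dd \<ge> 1 \<and> K \<ge> 1 \<and> M \<ge> 1 \<and> \<tau> \<ge> 1 \<and> 0 < \<epsilon> \<and> \<epsilon> \<le> 1 \<and>
       real \<tau> \<ge> 2 * real d * (2 * real d * L * (b - a) / \<epsilon> + 2) ^ d \<and>
       dd \<ge> \<tau> * (d + 1) + (\<tau> - 3) * \<tau> * (\<tau> + 1) + \<tau> + 1"
    then have dd: "1 \<le> dd" and K: "1 \<le> K" and M: "1 \<le> M" and \<epsilon>: "0 < \<epsilon>" "\<epsilon> \<le> 1"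
      and \<tau>: "2 * real d * (2 * real d * L * (b - a) / \<epsilon> + 2) ^ d \<le> real \<tau>"
      and D: "\<tau> * (d + 1) + (\<tau> - 3) * \<tau> * (\<tau> + 1) + \<tau> + 1 \<le> dd" by auto
    \<comment> \<open>The power is at least 2, so the hypothesis on \<open>\<tau>\<close> forces
      \<open>4 * d \<le> \<tau>\<close> and in particular \<open>3 \<le> \<tau>\<close>.\<close>
    have "2 * real d * 2 \<le> 2 * real d * (2 * real d * L * (b - a) / \<epsilon> + 2) ^ d"
    proof (rule mult_left_mono)
      have z: "2 \<le> 2 * real d * L * (b - a) / \<epsilon> + 2" using L0 ab \<epsilon> by simp
      also have "\<dots> \<le> (2 * real d * L * (b - a) / \<epsilon> + 2) ^ d" using z d_pos by (intro self_le_power) auto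
      finally show "2 \<le> (2 * real d * L * (b - a) / \<epsilon> + 2) ^ d" .
    qed simp
    then have "real (4 * d) \<le> real \<tau>" using \<tau> by simp
    then have "4 * d \<le> \<tau>" by (simp only: of_nat_le_iff)
    then have \<tau>d: "3 \<le> \<tau>" "d \<le> \<tau>" "1 \<le> \<tau>" using d_pos by auto
    define \<Lambda> where "\<Lambda> = (2 * R * real \<tau>) ^ \<tau>"
    have "1 * 1 \<le> 2 * R * real \<tau>" using R \<tau>d by (intro mult_mono) auto
    then have \<Lambda>1: "1 \<le> \<Lambda>" unfolding \<Lambda>_def by (intro one_le_power) simp
    have c\<Lambda>: "17 * R * \<Lambda> \<le> (c * real \<tau>) ^ \<tau>"
      unfolding \<Lambda>_def c_def using R \<tau>d by (intro scaled_power_ge) auto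
    have lipN: "\<bar>network d \<theta> \<tau> x - network d \<theta>' \<tau> x\<bar> \<le> \<Lambda> * \<delta>"
      if "\<theta> \<in> cube dd (-R) R" "\<theta>' \<in> cube dd (-R) R" "\<And>p. p \<in> {1..dd} \<Longrightarrow> \<bar>\<theta> p - \<theta>' p\<bar> \<le> \<delta>" "x \<in> cube d a b"
      for \<theta> \<theta>' \<delta> x
      unfolding \<Lambda>_def using R
      by (intro network_lipschitz[OF D _ \<tau>d(2,1) R(3,4) that]) auto
    obtain \<theta>\<^sub>0 where \<theta>\<^sub>0: "\<theta>\<^sub>0 \<in> cube dd (-R) R"
      "\<And>x. x \<in> cube d a b \<Longrightarrow> \<bar>network d \<theta>\<^sub>0 \<tau> x - \<phi> x\<bar> \<le> \<epsilon> / 2"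
      using network_approximation[OF D d_pos ab R(1) L0 R(2-4) \<phi>_range \<phi>_lip \<epsilon>(1) \<tau>] by metis
    \<comment> \<open>A parameter within \<open>\<delta>\<close> of \<open>\<theta>\<^sub>0\<close>
      has error at most \<open>\<epsilon> / 8 + \<epsilon> / 2\<close>, whose square is below
      \<open>\<epsilon>\<^sup>2 / 2\<close>.\<close>
    define \<delta> where "\<delta> = \<epsilon> / (8 * \<Lambda>)"
    have \<delta>: "0 < \<delta>" "\<delta> \<le> R" "\<Lambda> * \<delta> = \<epsilon> / 8"
    proof -
      show "0 < \<delta>" "\<Lambda> * \<delta> = \<epsilon> / 8" using \<epsilon> \<Lambda>1 by (auto simp: \<delta>_def)
      have "\<epsilon> / (8 * \<Lambda>) \<le> 1 / 1" using \<epsilon> \<Lambda>1 by (intro frac_le) auto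
      then show "\<delta> \<le> R" using R by (simp add: \<delta>_def)
    qed
    \<comment> \<open>With \<open>k\<close> cells per coordinate the net has radius
      \<open>R / k\<close>, at most \<open>\<epsilon>\<^sup>2 / (16 * \<Lambda>)\<close>. The
      quantity \<open>Q\<close> governs both terms of the result: it bounds \<open>k\<close> from
      above, and \<open>1 / Q\<close> bounds \<open>\<delta> / (2 * R)\<close> from below.\<close>
    define k where "k = nat \<lceil>16 * R * \<Lambda> / \<epsilon>\<^sup>2\<rceil>"
    define Q where "Q = (c * real \<tau>) ^ \<tau> / \<epsilon>\<^sup>2"
    have \<epsilon>2: "0 < \<epsilon>\<^sup>2" "\<epsilon>\<^sup>2 \<le> \<epsilon>" "\<epsilon>\<^sup>2 \<le> 1"
      using \<epsilon> by (auto simp: power2_eq_square mult_le_one mult_left_le)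
    have RL: "1 \<le> R * \<Lambda>" using mult_mono[of 1 R 1 \<Lambda>] R \<Lambda>1 by simp
    have k1: "16 * R * \<Lambda> / \<epsilon>\<^sup>2 \<le> real k" unfolding k_def by linarith
    have k0: "1 \<le> k"
    proof -
      have "0 < 16 * R * \<Lambda> / \<epsilon>\<^sup>2" using RL \<epsilon>2 by simp
      then show ?thesis using k1 by (cases k) auto
    qed
    have kQ: "real k \<le> Q"
    proof -
      \<comment> \<open>Rounding up costs at most 1, which
        \<open>R * \<Lambda> / \<epsilon>\<^sup>2\<close> absorbs; so 16 becomes 17.\<close>
      have "real k \<le> 16 * R * \<Lambda> / \<epsilon>\<^sup>2 + 1" using RL \<epsilon>2 unfolding k_def by simp
      also have "1 \<le> R * \<Lambda> / \<epsilon>\<^sup>2" using RL \<epsilon>2 by (simp add: le_divide_eq)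
      finally have "real k \<le> 17 * R * \<Lambda> / \<epsilon>\<^sup>2" by (simp add: add_divide_distrib[symmetric])
      also have "\<dots> \<le> Q" unfolding Q_def using c\<Lambda> \<epsilon>2 by (intro divide_right_mono) auto
      finally show ?thesis .
    qed
    have Q0: "0 < Q" using kQ k0 by linarith
    have radius: "\<Lambda> * ((R - (-R)) / (2 * real k)) \<le> \<epsilon>\<^sup>2 / 16"
      using k1 k0 \<epsilon>2 by (simp add: field_simps)
    obtain G where G: "finite G" "G \<noteq> {}" "G \<subseteq> cube dd (-R) R" "card G \<le> k ^ dd"
      "\<And>\<theta>. \<theta> \<in> cube dd (-R) R \<Longrightarrow> \<exists>g\<in>G. \<forall>i\<in>{1..dd}. \<bar>\<theta> i - g i\<bar> \<le> (R - (-R)) / (2 * real k)"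
      using cube_net_exists[of "-R" R k dd] k0 R by auto
    define A where "A = sub_box dd R \<theta>\<^sub>0 \<delta>"
    define miss where "miss = {\<omega> \<in> space P. \<forall>k\<in>{1..K}. Theta dd k \<omega> \<notin> A}"
    define dev where "dev g = {\<omega> \<in> space P. \<epsilon>\<^sup>2 / 4 \<le> \<bar>1 / real M * (\<Sum>m=1..M. f g \<tau> (X m \<omega>)) - E g \<tau>\<bar>}" for g
    have prob_A: "(\<delta> / (2 * R)) ^ dd \<le> measure (distr P (Rn dd) (Theta dd 1)) A"
      unfolding A_def Theta_unif[OF dd] by (rule uniform_measure_sub_box_ge[OF \<theta>\<^sub>0(1) \<delta>(1,2)])
    have p0: "0 \<le> (\<delta> / (2 * R)) ^ dd" using \<delta> R by simp
    have miss_sets: "miss \<in> events"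
      and miss_prob: "prob miss \<le> exp (- (real K * (\<delta> / (2 * R)) ^ dd))"
      unfolding miss_def
      using iid_no_hit[OF Theta_indep[OF dd] Theta_id[OF dd] sub_box_measurable p0 prob_A[unfolded A_def] K]
      by (simp_all only: A_def)
    have dev_prob: "prob (dev g) \<le> 2 * exp (- 2 * real M * (\<epsilon>\<^sup>2 / 4)\<^sup>2)" for g
      unfolding dev_def E_def
      using f01 M by (intro iid_empirical_mean_deviation[OF X_indep X_id fm]) auto
    have dev_sets: "dev g \<in> events" for g
    proof -
      have "(\<lambda>\<omega>. \<bar>1 / real M * (\<Sum>m=1..M. f g \<tau> (X m \<omega>)) - E g \<tau>\<bar>) \<in> borel_measurable P"
        by (intro borel_measurable_abs borel_measurable_diff borel_measurable_times borel_measurable_sum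
              borel_measurable_const measurable_compose[OF rvX fm]) auto
      then show ?thesis unfolding dev_def by measurable
    qed
    let ?\<Xi> = "\<lambda>\<omega>. selected_param d X \<phi> Theta dd K M \<tau> \<omega>"
    let ?ev = "{\<omega> \<in> space P. set_lebesgue_integral (distr P (Rn d) (X 1)) (cube d a b)
            (\<lambda>x. \<bar>network d (?\<Xi> \<omega>) \<tau> x - \<phi> x\<bar>) > \<epsilon>}"
    have "?ev \<subseteq> miss \<union> (\<Union>g\<in>G. dev g)"
    proof (rule subsetI, rule ccontr)
      fix \<omega> assume ev: "\<omega> \<in> ?ev" and "\<omega> \<notin> miss \<union> (\<Union>g\<in>G. dev g)"
      then have \<omega>: "\<omega> \<in> space P" and "\<omega> \<notin> miss" and nodev: "\<And>g. g \<in> G \<Longrightarrow> \<omega> \<notin> dev g" by auto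
      then obtain j where j: "j \<in> {1..K}" "Theta dd j \<omega> \<in> A" by (auto simp: miss_def)
      define \<xi> where "\<xi> = ?\<Xi> \<omega>"
      have Xc: "X m \<omega> \<in> cube d a b" if "m \<in> {1..M}" for m using X_range[OF _ \<omega>] that by auto
      have \<Theta>c: "Theta dd i \<omega> \<in> cube dd (-R) R" if "i \<in> {1..K}" for i
        using Theta_range[OF dd _ \<omega>] that by auto
      have \<xi>c: "\<xi> \<in> cube dd (-R) R"
        using selected_param_minimizes(1)[OF K, of d X \<phi> Theta dd M \<tau> \<omega>] \<Theta>c unfolding \<xi>_def by metis
      have mean_le: "1 / real M * (\<Sum>m=1..M. h m) \<le> u" if "\<And>m. m \<in> {1..M} \<Longrightarrow> h m \<le> u" for h :: "nat \<Rightarrow> real" and u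
      proof -
        have "(\<Sum>m=1..M. h m) \<le> (\<Sum>m=1..M. u)" using that by (intro sum_mono)
        then show ?thesis using M by (simp add: divide_le_eq mult.commute)
      qed
      have fit: "emp_risk d X \<phi> M \<tau> (Theta dd j \<omega>) \<omega> \<le> \<epsilon>\<^sup>2 / 2"
        unfolding emp[OF \<omega>]
      proof (rule mean_le)
        fix m assume "m \<in> {1..M}"
        note x = Xc[OF this]
        have "\<bar>Theta dd j \<omega> p - \<theta>\<^sub>0 p\<bar> \<le> \<delta>" if "p \<in> {1..dd}" for p
          using j(2) that by (auto simp: A_def sub_box_def PiE_def Pi_def abs_le_iff)
        from lipN[OF \<Theta>c[OF j(1)] \<theta>\<^sub>0(1) this x] \<theta>\<^sub>0(2)[OF x]
        have "\<bar>e (Theta dd j \<omega>) \<tau> (X m \<omega>)\<bar> \<le> 5 / 8 * \<epsilon>" unfolding e_cube[OF x] \<delta>(3) by linarith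
        then have "f (Theta dd j \<omega>) \<tau> (X m \<omega>) \<le> (5 / 8 * \<epsilon>)\<^sup>2" unfolding f_def by (intro power_mono) auto
        also have "\<dots> \<le> \<epsilon>\<^sup>2 / 2" by (simp add: power2_eq_square)
        finally show "f (Theta dd j \<omega>) \<tau> (X m \<omega>) \<le> \<epsilon>\<^sup>2 / 2" .
      qed
      have sel: "emp_risk d X \<phi> M \<tau> \<xi> \<omega> \<le> \<epsilon>\<^sup>2 / 2"
        using selected_param_minimizes(2)[OF K j(1), of d X \<phi> M \<tau> Theta dd \<omega>] fit unfolding \<xi>_def by linarith
      obtain g where g: "g \<in> G" "\<And>i. i \<in> {1..dd} \<Longrightarrow> \<bar>\<xi> i - g i\<bar> \<le> (R - (-R)) / (2 * real k)"
        using G(5)[OF \<xi>c] by auto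
      have gc: "g \<in> cube dd (-R) R" using g(1) G(3) by auto
      have close: "\<bar>f \<xi> \<tau> x - f g \<tau> x\<bar> \<le> \<epsilon>\<^sup>2 / 8" if x: "x \<in> cube d a b" for x
      proof -
        \<comment> \<open>Squaring is 2-Lipschitz on [-1,1], so a change of
          \<open>\<epsilon>\<^sup>2 / 16\<close> in the network becomes
          \<open>\<epsilon>\<^sup>2 / 8\<close> in the squared error.\<close>
        have "\<bar>f \<xi> \<tau> x - f g \<tau> x\<bar> \<le> 2 * \<bar>e \<xi> \<tau> x - e g \<tau> x\<bar>"
          unfolding f_def by (rule abs_square_diff_le[OF e1 e1])
        then have diff: "\<bar>f \<xi> \<tau> x - f g \<tau> x\<bar> \<le> 2 * \<bar>network d \<xi> \<tau> x - network d g \<tau> x\<bar>"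
          unfolding e_cube[OF x] by simp
        have "\<bar>network d \<xi> \<tau> x - network d g \<tau> x\<bar> \<le> \<Lambda> * ((R - (-R)) / (2 * real k))"
          by (rule lipN[OF \<xi>c gc g(2) x])
        from order.trans[OF this radius]
        have "2 * \<bar>network d \<xi> \<tau> x - network d g \<tau> x\<bar> \<le> 2 * (\<epsilon>\<^sup>2 / 16)"
          by (rule mult_left_mono) simp
        with diff show ?thesis by simp
      qed
      have "E \<xi> \<tau> \<le> expectation (\<lambda>\<omega>. f g \<tau> (X 1 \<omega>) + \<epsilon>\<^sup>2 / 8)"
        unfolding E_def
      proof (rule integral_mono)
        fix \<omega>' assume "\<omega>' \<in> space P"
        from close[OF X_range[OF order.refl this]] show "f \<xi> \<tau> (X 1 \<omega>') \<le> f g \<tau> (X 1 \<omega>') + \<epsilon>\<^sup>2 / 8" by linarith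
      qed (use fint in auto)
      also have "\<dots> = E g \<tau> + \<epsilon>\<^sup>2 / 8" unfolding E_def using fint by (simp add: prob_space)
      finally have E1: "E \<xi> \<tau> \<le> E g \<tau> + \<epsilon>\<^sup>2 / 8" .
      have E2: "E g \<tau> \<le> 1 / real M * (\<Sum>m=1..M. f g \<tau> (X m \<omega>)) + \<epsilon>\<^sup>2 / 4"
      proof -
        have "u \<le> s + t" if "\<not> t \<le> \<bar>s - u\<bar>" for s t u :: real using that by linarith
        moreover have "\<not> \<epsilon>\<^sup>2 / 4 \<le> \<bar>1 / real M * (\<Sum>m=1..M. f g \<tau> (X m \<omega>)) - E g \<tau>\<bar>"
          using nodev[OF g(1)] \<omega> unfolding dev_def by blast
        ultimately show ?thesis by blast
      qed
      have "1 / real M * (\<Sum>m=1..M. f g \<tau> (X m \<omega>) - f \<xi> \<tau> (X m \<omega>)) \<le> \<epsilon>\<^sup>2 / 8"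
      proof (rule mean_le)
        fix m assume "m \<in> {1..M}"
        from close[OF Xc[OF this]] show "f g \<tau> (X m \<omega>) - f \<xi> \<tau> (X m \<omega>) \<le> \<epsilon>\<^sup>2 / 8" by linarith
      qed
      then have "1 / real M * (\<Sum>m=1..M. f g \<tau> (X m \<omega>)) \<le> emp_risk d X \<phi> M \<tau> \<xi> \<omega> + \<epsilon>\<^sup>2 / 8"
        unfolding emp[OF \<omega>] sum_subtractf right_diff_distrib by (simp only: diff_le_eq add.commute)
      \<comment> \<open>The error budget is spent exactly: \<open>\<epsilon>\<^sup>2 / 8\<close>
        from \<open>\<xi>\<close> to \<open>g\<close> in the true risk,
        \<open>\<epsilon>\<^sup>2 / 4\<close> from true to empirical risk at \<open>g\<close>,
        \<open>\<epsilon>\<^sup>2 / 8\<close> back to \<open>\<xi>\<close>, and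
        \<open>\<epsilon>\<^sup>2 / 2\<close> for the empirical risk of
        \<open>\<xi>\<close>.\<close>
      with E1 E2 sel have "E \<xi> \<tau> \<le> \<epsilon>\<^sup>2" by linarith
      then have "expectation (\<lambda>\<omega>. \<bar>e \<xi> \<tau> (X 1 \<omega>)\<bar>) \<le> \<epsilon>"
        using e1 \<epsilon> unfolding E_def f_def by (intro expectation_abs_le X1m em) auto
      with ev show False unfolding L1_error \<xi>_def by simp
    qed
    \<comment> \<open>Monotonicity asks for measurability of the covering event only; a
      non-measurable \<open>?ev\<close> would have measure 0 by convention.\<close>
    then have "prob ?ev \<le> prob (miss \<union> (\<Union>g\<in>G. dev g))"
      using miss_sets dev_sets G(1) by (intro finite_measure_mono sets.Un sets.finite_UN) auto
    also have "\<dots> \<le> prob miss + prob (\<Union>g\<in>G. dev g)"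
      using miss_sets dev_sets G(1) by (intro measure_Un_le sets.finite_UN) auto
    also have "prob miss \<le> exp (- (real K * \<epsilon> ^ (2 * dd) / (c * real \<tau>) ^ (\<tau> * dd)))"
    proof -
      \<comment> \<open>Compares \<open>\<epsilon>\<^sup>2 / (c * \<tau>) ^ \<tau>\<close> with
        \<open>\<epsilon> / (16 * R * \<Lambda>)\<close> through
        \<open>\<epsilon>\<^sup>2 \<le> \<epsilon>\<close> and the bound \<open>c\<Lambda>\<close>;
        this is where the exponent \<open>2 * dd\<close> of \<open>\<epsilon>\<close>
        arises.\<close>
      have "1 / Q \<le> \<delta> / (2 * R)"
      proof -
        have "1 / Q = \<epsilon>\<^sup>2 / (c * real \<tau>) ^ \<tau>" by (simp add: Q_def)
        also have "\<dots> \<le> \<epsilon> / (16 * R * \<Lambda>)"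
          using \<epsilon>2 RL c\<Lambda> \<epsilon> by (intro frac_le) auto
        also have "\<dots> = \<delta> / (2 * R)" by (simp add: \<delta>_def)
        finally show ?thesis .
      qed
      then have "(1 / Q) ^ dd \<le> (\<delta> / (2 * R)) ^ dd" using Q0 by (intro power_mono) auto
      then have "real K * (1 / Q) ^ dd \<le> real K * (\<delta> / (2 * R)) ^ dd" by (rule mult_left_mono) simp
      moreover have "real K * \<epsilon> ^ (2 * dd) / (c * real \<tau>) ^ (\<tau> * dd) = real K * (1 / Q) ^ dd"
        by (simp add: Q_def power_divide power_mult)
      ultimately show ?thesis using miss_prob by (intro order.trans[OF miss_prob]) simp
    qed
    also have "prob (\<Union>g\<in>G. dev g) \<le> 2 * exp (real dd * ln Q - \<epsilon> ^ 4 * real M / c)"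
    proof -
      have "prob (\<Union>g\<in>G. dev g) \<le> (\<Sum>g\<in>G. prob (dev g))"
        using dev_sets G(1) by (intro finite_measure_subadditive_finite) auto
      also have "\<dots> \<le> (\<Sum>g\<in>G. 2 * exp (- 2 * real M * (\<epsilon>\<^sup>2 / 4)\<^sup>2))" by (intro sum_mono dev_prob)
      also have "\<dots> = real (card G) * (2 * exp (- 2 * real M * (\<epsilon>\<^sup>2 / 4)\<^sup>2))" by simp
      also have "\<dots> \<le> Q ^ dd * (2 * exp (- (\<epsilon> ^ 4 * real M / c)))"
      proof (rule mult_mono)
        have "real (card G) \<le> real k ^ dd" using G(4) by (metis of_nat_le_iff of_nat_power)
        also have "\<dots> \<le> Q ^ dd" using kQ by (intro power_mono) auto
        finally show "real (card G) \<le> Q ^ dd" .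
        \<comment> \<open>Deviation \<open>\<epsilon>\<^sup>2 / 4\<close> in Hoeffding's inequality
          gives the exponent \<open>\<epsilon> ^ 4 * M / 8\<close>; replacing 8 by the larger
          \<open>c\<close> weakens the bound.\<close>
        have "\<epsilon> ^ 4 * real M / c \<le> \<epsilon> ^ 4 * real M / 8" using c8 by (intro divide_left_mono) auto
        also have "\<dots> = 2 * real M * (\<epsilon>\<^sup>2 / 4)\<^sup>2" by (simp add: power_divide)
        finally show "2 * exp (- 2 * real M * (\<epsilon>\<^sup>2 / 4)\<^sup>2) \<le> 2 * exp (- (\<epsilon> ^ 4 * real M / c))" by simp
      qed (use Q0 in auto)
      also have "Q ^ dd = exp (real dd * ln Q)" using Q0 by (simp add: exp_of_nat_mult)
      also have "exp (real dd * ln Q) * (2 * exp (- (\<epsilon> ^ 4 * real M / c))) = 2 * exp (real dd * ln Q - \<epsilon> ^ 4 * real M / c)"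
        by (simp add: exp_diff exp_minus divide_inverse)
      finally show ?thesis .
    qed
    finally show "prob ?ev \<le> exp (- (real K * \<epsilon> ^ (2 * dd) / (c * real \<tau>) ^ (\<tau> * dd)))
         + 2 * exp (real dd * ln ((c * real \<tau>) ^ \<tau> / \<epsilon>^2) - \<epsilon>^4 * real M / c)"
      unfolding Q_def by simp
  qed
qed

end
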